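(* Let $k$ be a field of characteristic $p>0$ and let $l,m\ge1$, $t\ge2$ be integers with $mt\ge3$ and $p\mid t$. In $k[x_1,x_2,x_3]$ put $f:=x_1x_3-x_2^t$, $r:=f^lx_2+x_1^m$, $g:=x_1^{-1}(f^{lt+1}+r^t)$; let $\epsilon$ be the $\mathbf{G}_a$-action described in the context, let $0\ne h\in k[f,g]$, and put $q:=r^p-(f^lgh)^{p-1}r$ and $q_1:=g^{-1}(f^{lt+1}+q^{t/p})$. Let $\psi:C[r^p]\to C[r]$ be the $C$-algebra homomorphism $u(r^p)\mapsto u(q)$. Then: (i) there exist $q_2,q_3\in k[x_1,x_2,x_3]^{\epsilon_h}$ such that $q_1q_3-q_2^{t/p}=f$ and $k[x_1,x_2,x_3]^{\epsilon_h}=k[q_1,q_2,q_3]$; (ii) $\psi(k[x_1,x_2^p,x_3])=k[x_1,x_2,x_3]^{\epsilon_h}$ if and only if $h^{p-1}\in f^l\,k[f,g]$.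
   Context: The element $g$ is a polynomial; $f,g,r$ are algebraically independent over $k$, and with $C:=k[f^{\pm1},g^{\pm1}]\subset k(x_1,x_2,x_3)$ one has $k[x_1,x_2,x_3]\subset C[r]$, a polynomial ring in $r$ over $C$. Let $\tilde\epsilon:C[r]\to C[r][T]$ be the $C$-algebra homomorphism $u(r)\mapsto u(r+f^lgT)$; it maps $k[x_1,x_2,x_3]$ into $k[x_1,x_2,x_3][T]$, and $\epsilon$ is its restriction. For $b\in k[x_1,x_2,x_3]$, $\epsilon_h(b):=\epsilon(b)|_{T=h}$ defines a $k$-automorphism $\epsilon_h$ of $k[x_1,x_2,x_3]$, and $k[x_1,x_2,x_3]^{\epsilon_h}:=\{b\mid\epsilon_h(b)=b\}$. When $p\mid t$, one has $x_1,x_2^p,x_3\in C[r^p]$, so $\psi$ is defined on $k[x_1,x_2^p,x_3]$; also $q_1\in k[x_1,x_2,x_3]$. *)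

theory Defs
  imports "HOL-Computational_Algebra.Polynomial" "HOL-Computational_Algebra.Fraction_Field"
begin

text \<open>The polynomial ring k[x1,x2,x3] is modelled as 'k poly poly poly
 (outermost variable x3, middle x2, innermost x1); its fraction field
 k(x1,x2,x3) is ('k poly poly poly) fract. Everything is computed inside
 the fraction field.\<close>

type_synonym 'k rat3 = "'k poly poly poly fract"

definition emb3 :: "'k::field poly poly poly \<Rightarrow> 'k rat3" where
  "emb3 P = Fract P 1"

definition constK :: "'k::field \<Rightarrow> 'k rat3" where
  "constK c = emb3 [:[:[:c:]:]:]"

definition X1 :: "'k::field rat3" where "X1 = emb3 [:[:[:0, 1:]:]:]"
definition X2 :: "'k::field rat3" where "X2 = emb3 [:[:0, 1:]:]"
definition X3 :: "'k::field rat3" where "X3 = emb3 [:0, 1:]"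

definition polyring :: "'k::field rat3 set" where
  "polyring = range emb3"

inductive_set kalg :: "'k::field rat3 set \<Rightarrow> 'k rat3 set" for S where
  const: "constK c \<in> kalg S"
| gen: "s \<in> S \<Longrightarrow> s \<in> kalg S"
| add: "a \<in> kalg S \<Longrightarrow> b \<in> kalg S \<Longrightarrow> a + b \<in> kalg S"
| mult: "a \<in> kalg S \<Longrightarrow> b \<in> kalg S \<Longrightarrow> a * b \<in> kalg S"
| uminus: "a \<in> kalg S \<Longrightarrow> - a \<in> kalg S"

text \<open>For a subring C, an element y (transcendental over C) and b in C[y]:
 the C-algebra substitution u(y) |-> u(z), i.e. write b = u(y) with u having
 coefficients in C and return u(z).\<close>
definition subst_over :: "'k::field rat3 set \<Rightarrow> 'k rat3 \<Rightarrow> 'k rat3 \<Rightarrow> 'k rat3 \<Rightarrow> 'k rat3" where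
  "subst_over C y z b = poly (THE u. (\<forall>i. coeff u i \<in> C) \<and> poly u y = b) z"

end

theory Submission
  imports Defs "HOL-Computational_Algebra.Polynomial_Factorial"
begin

text \<open>
  Since the translation by $s = f^l g h$ has order $p$, its invariants in $C[r]$ are the polynomials in
  $q = r^p - s^{p-1} r$, so the ring of invariants is $k[x_1,x_2,x_3] \cap C[q]$. Modulo $f^l$ one has
  $q_1 \equiv x_1$ and $g \equiv q_1^{mt-1}$, which yields $\theta \in k[f,q_1]$ with
  $q \equiv q_1 \theta$ modulo $f^{lp}$. With $q_2 = f^{-lp}(q - q_1\theta)$ and
  $q_3 = q_1^{-1}(f + q_2^{t/p})$, the algebra $B = k[q_1,q_2,q_3]$ contains $f$, $g$, $q$ and has the same
  localization at $fg$ as $C[q]$. It remains to see that $B/fB$ and $B_f/gB_f$ embed into the corresponding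
  quotients of $k[x_1,x_2,x_3]$: modulo $f$ because $q_2 \equiv x_2^p + c_1 x_2 + c_0$ with
  $c_i \in k[x_1]$, and modulo $g$ because the quotient is parametrized by
  $f = -\tau^t$, $r = (-1)^l \tau^{lt+1}$, on which the powers $q^i$ with $i < t/p$ are independent over $k[f]$.
  For (ii), $\psi$ maps $x_1, x_2^p, x_3$ to such a triple with $\theta = q_1^{mp-1}$, which lies in
  $k[x_1,x_2,x_3]$ exactly if $f^l$ divides $h^{p-1}$.
\<close>

section \<open>Ring homomorphisms and generated subalgebras\<close>

text \<open>The obstacle is divisibility: q2 and q3 arise by dividing by powers of f, and the
  formulas alone do not show that the quotients are polynomials. Hence \<open>R\<close>,
  \<open>G\<close>, \<open>Q\<close>, \<open>Q1\<close> are kept in the polynomial ring and the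
  congruences are proved there, with x1 and q1 cancelled against powers of f. That theta lies in
  k[f,q1], and not merely in the polynomial ring, is what gives q = f^(lp) q2 + q1 theta in B, and
  then g in B. The two embeddings say that f a in B or g a in B forces a in B, for a polynomial a.
  An invariant polynomial lies in C[q], so some (fg)^n times it lies in k[f,g,q], which is contained
  in B, and the factors f and g can be removed one by one. Inverting f before reducing modulo g
  eliminates q2 and q3 and leaves the relation g q1 = f^(lt+1) + q^(t/p). Independence in the
  quotients is tested by k-algebra maps into k(x1,x2,x3), which is infinite even for finite
  k.\<close>

locale ring_map =
  fixes \<phi> :: "'a::comm_ring_1 \<Rightarrow> 'b::comm_ring_1"
  assumes one [simp]: "\<phi> 1 = 1"
    and add [simp]: "\<phi> (a + b) = \<phi> a + \<phi> b"
    and mult [simp]: "\<phi> (a * b) = \<phi> a * \<phi> b"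
begin

lemma zero [simp]: "\<phi> 0 = 0"
  using add[of 0 0] by (simp del: add)

lemma uminus [simp]: "\<phi> (- a) = - \<phi> a"
  using add[of a "- a"] by (simp del: add add: eq_neg_iff_add_eq_0 add.commute)

lemma diff [simp]: "\<phi> (a - b) = \<phi> a - \<phi> b"
  using add[of a "- b"] by (simp del: add)

lemma power [simp]: "\<phi> (a ^ n) = \<phi> a ^ n"
  by (induction n) auto

lemma sum [simp]: "\<phi> (\<Sum>i\<in>I. f i) = (\<Sum>i\<in>I. \<phi> (f i))"
  by (induction I rule: infinite_finite_induct) auto

lemma dvd: "a dvd b \<Longrightarrow> \<phi> a dvd \<phi> b"
  by (auto elim!: dvdE)

end

lemma ring_map_comp: "ring_map \<phi> \<Longrightarrow> ring_map \<chi> \<Longrightarrow> ring_map (\<lambda>x. \<chi> (\<phi> x))"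
  unfolding ring_map_def by auto

text \<open>Iterating it, as in \<open>evalh (evalh \<kappa> x) y\<close>, evaluates polynomials in
  several variables that are encoded by nested polynomial types.\<close>

definition evalh :: "('a::comm_ring_1 \<Rightarrow> 'b::comm_ring_1) \<Rightarrow> 'b \<Rightarrow> 'a poly \<Rightarrow> 'b" where
  "evalh \<kappa> x P = poly (map_poly \<kappa> P) x"

context ring_map
begin

lemma coeff_map [simp]: "coeff (map_poly \<phi> P) n = \<phi> (coeff P n)"
  by (simp add: coeff_map_poly)

lemma map_poly_hom: "ring_map (map_poly \<phi>)"
proof
  show "map_poly \<phi> (P * Q) = map_poly \<phi> P * map_poly \<phi> Q" for P Q
    by (rule poly_eqI) (simp add: coeff_mult)
qed (auto intro: poly_eqI)

lemma evalh_hom: "ring_map (evalh \<phi> x)"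
proof -
  interpret M: ring_map "map_poly \<phi>" by (rule map_poly_hom)
  show ?thesis by standard (simp_all add: evalh_def)
qed

lemma evalh_pCons [simp]: "evalh \<phi> x (pCons a P) = \<phi> a + x * evalh \<phi> x P"
proof -
  have "map_poly \<phi> (pCons a P) = pCons (\<phi> a) (map_poly \<phi> P)"
    by (rule poly_eqI) (simp add: coeff_pCons split: nat.splits)
  then show ?thesis by (simp add: evalh_def)
qed

lemma evalh_const: "evalh \<phi> x [:c:] = \<phi> c"
  by (simp add: evalh_def map_poly_pCons)

lemma evalh_0 [simp]: "evalh \<phi> x 0 = 0"
  by (simp add: evalh_def)

lemma hom_evalh:
  assumes "ring_map \<chi>"
  shows "\<chi> (evalh \<phi> x P) = evalh (\<lambda>c. \<chi> (\<phi> c)) (\<chi> x) P"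
proof -
  interpret X: ring_map \<chi> by fact
  interpret XP: ring_map "\<lambda>c. \<chi> (\<phi> c)"
    by (rule ring_map_comp[OF ring_map_axioms assms])
  show ?thesis by (induction P) simp_all
qed

end

lemma ring_map_poly: "ring_map (\<lambda>P. poly P x)"
  by standard auto

text \<open>The base map is a parameter, so that the same facts serve the polynomial ring
  (\<open>const3\<close>), where divisibility has content, and its fraction field
  (\<open>constK\<close>), where \<open>kalg\<close> lives.\<close>

inductive_set alg :: "('k \<Rightarrow> 'b::comm_ring_1) \<Rightarrow> 'b set \<Rightarrow> 'b set" for \<kappa> S where
  const: "\<kappa> c \<in> alg \<kappa> S"
| gen: "s \<in> S \<Longrightarrow> s \<in> alg \<kappa> S"
| add: "a \<in> alg \<kappa> S \<Longrightarrow> b \<in> alg \<kappa> S \<Longrightarrow> a + b \<in> alg \<kappa> S"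
| mult: "a \<in> alg \<kappa> S \<Longrightarrow> b \<in> alg \<kappa> S \<Longrightarrow> a * b \<in> alg \<kappa> S"
| uminus: "a \<in> alg \<kappa> S \<Longrightarrow> - a \<in> alg \<kappa> S"

lemma alg_diff: "a \<in> alg \<kappa> S \<Longrightarrow> b \<in> alg \<kappa> S \<Longrightarrow> a - b \<in> alg \<kappa> S"
  using alg.add[OF _ alg.uminus, of a \<kappa> S b] by simp

lemma alg_least:
  assumes "a \<in> alg \<kappa> S" and "\<And>s. s \<in> S \<Longrightarrow> s \<in> alg \<kappa> T"
  shows "a \<in> alg \<kappa> T"
  using assms(1) by induction (auto intro: alg.intros assms(2))

lemma alg_mono: "S \<subseteq> T \<Longrightarrow> a \<in> alg \<kappa> S \<Longrightarrow> a \<in> alg \<kappa> T"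
  by (erule alg_least) (auto intro: alg.gen)

context ring_map
begin

lemma alg_0: "0 \<in> alg \<phi> S"
  using alg.const[of \<phi> 0 S] by simp

lemma alg_1: "1 \<in> alg \<phi> S"
  using alg.const[of \<phi> 1 S] by simp

lemma alg_power: "a \<in> alg \<phi> S \<Longrightarrow> a ^ n \<in> alg \<phi> S"
  by (induction n) (auto intro: alg.intros alg_1)

lemma alg_sum: "(\<And>i. i \<in> I \<Longrightarrow> f i \<in> alg \<phi> S) \<Longrightarrow> (\<Sum>i\<in>I. f i) \<in> alg \<phi> S"
  by (induction I rule: infinite_finite_induct) (auto intro: alg.intros alg_0)

lemma alg_evalh: "x \<in> alg \<phi> S \<Longrightarrow> evalh \<phi> x P \<in> alg \<phi> S"
  by (induction P) (auto intro: alg.intros alg_0)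

text \<open>The elements that multiply \<open>T\<close> into itself are closed under the ring
  operations, so stability under the generators is enough. Normal forms can thus be established
  without ever multiplying two of them.\<close>

lemma alg_module_induct:
  assumes "a \<in> alg \<phi> S"
    and one: "1 \<in> T"
    and scale: "\<And>c x. x \<in> T \<Longrightarrow> \<phi> c * x \<in> T"
    and plus: "\<And>x y. x \<in> T \<Longrightarrow> y \<in> T \<Longrightarrow> x + y \<in> T"
    and gens: "\<And>s x. s \<in> S \<Longrightarrow> x \<in> T \<Longrightarrow> s * x \<in> T"
  shows "a \<in> T"
proof -
  have "\<forall>x\<in>T. a * x \<in> T"
    using assms(1)
  proof induction
    case (uminus a)
    show ?case
    proof
      fix x assume "x \<in> T"
      then have "\<phi> (-1) * (a * x) \<in> T" using uminus scale by blast
      then show "- a * x \<in> T" by simp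
    qed
  qed (auto simp: distrib_right mult.assoc scale plus gens)
  from bspec[OF this one] show ?thesis by simp
qed

lemma alg_clear_denominator:
  assumes "a \<in> alg \<phi> S" and "f \<in> alg \<phi> T"
    and gens: "\<And>s. s \<in> S \<Longrightarrow> \<exists>n. f ^ n * s \<in> alg \<phi> T"
  shows "\<exists>n. f ^ n * a \<in> alg \<phi> T"
  using assms(1)
proof induction
  case (const c) then show ?case by (intro exI[of _ 0]) (simp add: alg.const)
next
  case (gen s) then show ?case by (rule gens)
next
  case (add a b)
  then obtain i j where "f ^ i * a \<in> alg \<phi> T" "f ^ j * b \<in> alg \<phi> T" by blast
  then have "f ^ j * (f ^ i * a) + f ^ i * (f ^ j * b) \<in> alg \<phi> T"
    by (metis alg.add alg.mult alg_power assms(2))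
  then show ?case by (intro exI[of _ "i + j"]) (simp add: power_add algebra_simps)
next
  case (mult a b)
  then obtain i j where "f ^ i * a \<in> alg \<phi> T" "f ^ j * b \<in> alg \<phi> T" by blast
  then have "(f ^ i * a) * (f ^ j * b) \<in> alg \<phi> T" by (rule alg.mult)
  then show ?case by (intro exI[of _ "i + j"]) (simp add: power_add algebra_simps)
next
  case (uminus a)
  then obtain i where "f ^ i * a \<in> alg \<phi> T" by blast
  then have "- (f ^ i * a) \<in> alg \<phi> T" by (rule alg.uminus)
  then show ?case by (intro exI[of _ i]) simp
qed

lemma image_alg:
  fixes \<kappa> :: "'k \<Rightarrow> 'a"
  shows "\<phi> ` alg \<kappa> S = alg (\<lambda>c. \<phi> (\<kappa> c)) (\<phi> ` S)"
proof
  show "\<phi> ` alg \<kappa> S \<subseteq> alg (\<lambda>c. \<phi> (\<kappa> c)) (\<phi> ` S)"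
  proof clarify
    fix a assume "a \<in> alg \<kappa> S"
    then show "\<phi> a \<in> alg (\<lambda>c. \<phi> (\<kappa> c)) (\<phi> ` S)"
      by induction (auto intro: alg.intros alg.const[where \<kappa> = "\<lambda>c. \<phi> (\<kappa> c)"])
  qed
  show "alg (\<lambda>c. \<phi> (\<kappa> c)) (\<phi> ` S) \<subseteq> \<phi> ` alg \<kappa> S"
  proof
    fix a assume "a \<in> alg (\<lambda>c. \<phi> (\<kappa> c)) (\<phi> ` S)"
    then show "a \<in> \<phi> ` alg \<kappa> S"
    proof induction
      case (add a b)
      then obtain a' b' where "a = \<phi> a'" "b = \<phi> b'" "a' \<in> alg \<kappa> S" "b' \<in> alg \<kappa> S" by blast
      then show ?case by (intro image_eqI[of _ _ "a' + b'"]) (auto intro: alg.add)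
    next
      case (mult a b)
      then obtain a' b' where "a = \<phi> a'" "b = \<phi> b'" "a' \<in> alg \<kappa> S" "b' \<in> alg \<kappa> S" by blast
      then show ?case by (intro image_eqI[of _ _ "a' * b'"]) (auto intro: alg.mult)
    next
      case (uminus a)
      then obtain a' where "a = \<phi> a'" "a' \<in> alg \<kappa> S" by blast
      then show ?case by (intro image_eqI[of _ _ "- a'"]) (auto intro: alg.uminus)
    qed (auto intro: alg.const alg.gen)
  qed
qed

end

lemma alg_eqI:
  assumes "ring_map \<phi>" "ring_map \<chi>" "a \<in> alg \<kappa> S"
    and "\<And>c. \<phi> (\<kappa> c) = \<chi> (\<kappa> c)" and "\<And>s. s \<in> S \<Longrightarrow> \<phi> s = \<chi> s"
  shows "\<phi> a = \<chi> a"
proof -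
  interpret \<phi>: ring_map \<phi> by fact
  interpret \<chi>: ring_map \<chi> by fact
  show ?thesis using assms(3) by induction (auto simp: assms)
qed

lemma kalg_eq_alg: "kalg S = alg constK S"
proof (rule set_eqI, rule iffI)
  show "a \<in> kalg S \<Longrightarrow> a \<in> alg constK S" for a
    by (induction rule: kalg.induct) (auto intro: alg.intros)
  show "a \<in> alg constK S \<Longrightarrow> a \<in> kalg S" for a
    by (induction rule: alg.induct) (auto intro: kalg.intros)
qed

definition const3 :: "'k::field \<Rightarrow> 'k poly poly poly" where "const3 c = [:[:[:c:]:]:]"

lemma ring_map_const3: "ring_map const3"
  by standard (auto simp: const3_def one_pCons)

lemma ring_map_emb3: "ring_map emb3"
  by standard (auto simp: emb3_def One_fract_def)

lemma inj_emb3: "emb3 a = emb3 b \<longleftrightarrow> a = b"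
  by (simp add: emb3_def eq_fract)

lemma constK_eq: "constK c = emb3 (const3 c)"
  by (simp add: constK_def const3_def)

lemma ring_map_constK: "ring_map constK"
  using ring_map_comp[OF ring_map_const3 ring_map_emb3] by (simp add: constK_eq[abs_def])

interpretation c3: ring_map const3 by (rule ring_map_const3)
interpretation e3: ring_map emb3 by (rule ring_map_emb3)
interpretation cK: ring_map constK by (rule ring_map_constK)

lemma emb3_image_alg: "emb3 ` alg const3 S = alg constK (emb3 ` S)"
  by (simp add: e3.image_alg constK_eq[abs_def])

lemma emb3_in_alg: "a \<in> alg const3 S \<Longrightarrow> emb3 a \<in> alg constK (emb3 ` S)"
  using emb3_image_alg by blast

lemma emb3_in_alg_iff: "emb3 a \<in> alg constK (emb3 ` S) \<longleftrightarrow> a \<in> alg const3 S"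
  unfolding emb3_image_alg[symmetric] by (auto simp: inj_emb3)

lemma CHAR_fract: "CHAR('a::idom fract) = CHAR('a)"
  by (rule CHAR_eqI) (auto simp: of_nat_fract Zero_fract_def eq_fract of_nat_eq_0_iff_char_dvd)

section \<open>The polynomial ring as the free commutative k-algebra on three variables\<close>

definition x1 :: "'k::field poly poly poly" where "x1 = [:[:[:0, 1:]:]:]"
definition x2 :: "'k::field poly poly poly" where "x2 = [:[:0, 1:]:]"
definition x3 :: "'k::field poly poly poly" where "x3 = [:0, 1:]"

definition subst3 ::
    "'k::field rat3 \<Rightarrow> 'k rat3 \<Rightarrow> 'k rat3 \<Rightarrow> 'k poly poly poly \<Rightarrow> 'k rat3" where
  "subst3 a b c = evalh (evalh (evalh constK a) b) c"

lemma ring_map_subst3: "ring_map (subst3 a b c)"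
  unfolding subst3_def
  by (intro ring_map.evalh_hom ring_map_constK)

lemma subst3_simps [simp]:
  "subst3 a b c x1 = a" "subst3 a b c x2 = b" "subst3 a b c x3 = c"
  "subst3 a b c (const3 k) = constK k"
proof -
  note R = ring_map.evalh_hom[OF ring_map_constK, of a]
  interpret R1: ring_map "evalh constK a" by (rule R)
  interpret R2: ring_map "evalh (evalh constK a) b" by (rule R1.evalh_hom)
  show "subst3 a b c x1 = a" "subst3 a b c x2 = b" "subst3 a b c x3 = c"
    "subst3 a b c (const3 k) = constK k"
    by (simp_all add: subst3_def const3_def x1_def x2_def x3_def R1.evalh_const R2.evalh_const cK.evalh_const)
qed

lemma alg_x123: "a \<in> alg const3 {x1, x2, x3}"
proof -
  have c: "evalh (\<lambda>c. [:[:[:c:]:]:]) x1 u = [:[:u:]:]" for u :: "'k::field poly"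
  proof -
    interpret ring_map "\<lambda>c. [:[:[:c:]:]:]" by standard (auto simp: one_pCons)
    show ?thesis by (induction u) (auto simp: x1_def)
  qed
  have 1: "[:[:u:]:] \<in> alg const3 {x1, x2, x3}" for u
    using c3.alg_evalh[of x1 "{x1,x2,x3}" u] c[of u]
    by (simp add: const3_def[abs_def] alg.gen)
  have 2: "[:v:] \<in> alg const3 {x1, x2, x3}" for v
  proof (induction v)
    case 0 show ?case using c3.alg_0 by simp
  next
    case (pCons u v)
    have "[:pCons u v:] = [:[:u:]:] + x2 * [:v:]" by (simp add: x2_def)
    then show ?case using pCons 1 by (metis alg.add alg.mult alg.gen insertI1 insertI2)
  qed
  show ?thesis
  proof (induction a)
    case 0 show ?case by (rule c3.alg_0)
  next
    case (pCons v a)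
    have "pCons v a = [:v:] + x3 * a" by (simp add: x3_def)
    then show ?case using pCons 2 by (metis alg.add alg.mult alg.gen insertI1 insertI2)
  qed
qed

lemma X_eq: "X1 = emb3 x1" "X2 = emb3 x2" "X3 = emb3 x3"
  by (simp_all add: X1_def X2_def X3_def x1_def x2_def x3_def)

lemma inj_X2_powers: "inj (\<lambda>n. X2 ^ n :: 'k::field rat3)"
proof (rule injI)
  fix m n assume "X2 ^ m = (X2 ^ n :: 'k rat3)"
  then have "(x2 :: 'k poly poly poly) ^ m = x2 ^ n"
    by (simp add: X_eq inj_emb3 flip: e3.power)
  then have "[:[:0,1:] ^ m:] = [:([:0,1:] :: 'k poly poly) ^ n:]"
    by (simp add: poly_const_pow x2_def)
  then show "m = n"
    using degree_linear_power[of "0 :: 'k poly"] by (metis pCons_eq_iff)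
qed

text \<open>The powers of \<open>X2\<close> are infinitely many field elements whatever k is. This
  lets polynomial identities be verified by specialization at almost all points.\<close>

lemma poly_eq_0_cofinite:
  fixes W :: "'k::field rat3 poly"
  assumes "finite E" and "\<And>x. x \<notin> E \<Longrightarrow> poly W x = 0"
  shows "W = 0"
proof (rule ccontr)
  assume "W \<noteq> 0"
  then have "finite {x. poly W x = 0}" by (rule poly_roots_finite)
  with assms have "finite (UNIV :: 'k rat3 set)"
    by (metis (mono_tags, lifting) UNIV_eq_I Un_iff finite_UnI mem_Collect_eq)
  then have "finite (range (\<lambda>n. X2 ^ n :: 'k rat3))" by (rule finite_subset[OF subset_UNIV])
  with inj_X2_powers show False using finite_imageD infinite_UNIV_nat by blast
qed

lemma map_constK_eq_0 [simp]: "map_poly constK P = 0 \<longleftrightarrow> P = 0"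
proof -
  have "constK c = 0 \<longleftrightarrow> c = 0" for c :: 'a
    using inj_emb3[of "const3 c" 0] by (simp add: constK_eq const3_def)
  then show ?thesis by (auto simp: poly_eq_iff)
qed

section \<open>Congruences modulo powers of f\<close>

lemma prime_elem_x1: "prime_elem (x1 :: 'k::field poly poly poly)"
  unfolding x1_def by (intro lift_prime_elem_poly prime_elem_linear_field_poly) simp

lemma x1_neq_0 [simp]: "x1 \<noteq> 0"
  by (simp add: x1_def)

lemma x1_not_dvd_x2: "\<not> (x1 :: 'k::field poly poly poly) dvd x2"
proof
  assume "(x1 :: 'k poly poly poly) dvd x2"
  then have "[:0, 1:] dvd (1 :: 'k poly)"
    by (auto simp: x1_def x2_def const_poly_dvd_iff coeff_pCons split: nat.splits)
  then show False by (simp add: is_unit_iff_degree)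
qed

text \<open>The data are polynomials, so that divisibility by \<open>F\<close> is meaningful.
  \<open>G\<close> is given by its relation with \<open>x1\<close> instead of by a quotient,
  \<open>e\<close> is t/p, and \<open>H\<close> is the polynomial that represents h.\<close>

locale action =
  fixes p l m t e :: nat and F R G H :: "'k::field poly poly poly"
  assumes CHAR_p: "CHAR('k) = p" and p_pos: "p > 0" and l: "l \<ge> 1" and m: "m \<ge> 1"
    and mt: "m * t \<ge> 2" and t: "t = p * e"
    and F: "F = x1 * x3 - x2 ^ t" and R: "R = F ^ l * x2 + x1 ^ m"
    and G: "x1 * G = F ^ (l * t + 1) + R ^ t"
    and H: "H \<in> alg const3 {F, G}"
begin

lemma prime_p: "prime p"
  using prime_CHAR_semidom[where ?'a = 'k] CHAR_p p_pos by simp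

lemma p2: "p \<ge> 2"
  using prime_p by (rule prime_ge_2_nat)

lemma e1: "e \<ge> 1"
  using mt t by (cases e) auto

lemma add_power_p: "(a + b) ^ p = a ^ p + (b :: 'k poly poly poly) ^ p"
  by (rule freshmans_dream) (simp_all add: CHAR_p prime_p)

lemma diff_power_p: "(a - b) ^ p = a ^ p - (b :: 'k poly poly poly) ^ p"
  using add_power_p[of "a - b" b] by (simp add: algebra_simps)

lemma F_neq_0: "F \<noteq> 0"
proof
  assume "F = 0"
  then have "x1 * x3 = (x2 ^ t :: 'k poly poly poly)" by (simp add: F)
  from this[symmetric]
  have "(x1 :: 'k poly poly poly) dvd x2 ^ t" by simp
  then show False using prime_elem_x1 x1_not_dvd_x2 prime_elem_dvd_power by blast
qed

text \<open>Modulo \<open>x1\<close>, \<open>F\<close> is \<open>- (x2 ^ t)\<close>, and the prime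
  \<open>x1\<close> does not divide \<open>x2\<close>. So \<open>x1 * y = F * w\<close> forces
  \<open>x1\<close> to divide \<open>w\<close>; powers of \<open>F\<close> are split off one at a
  time.\<close>

lemma cancel_x1: "F ^ n dvd x1 * y \<Longrightarrow> F ^ n dvd y"
proof (induction n arbitrary: y)
  case (Suc n)
  from Suc.prems obtain z where "x1 * y = F ^ Suc n * z" ..
  define w where "w = F ^ n * z"
  have z: "x1 * y = F * w" using \<open>x1 * y = F ^ Suc n * z\<close> by (simp add: w_def mult.assoc)
  have "x2 ^ t * w = x1 * x3 * w - F * w" unfolding F by (simp add: algebra_simps)
  also have "\<dots> = x1 * (x3 * w - y)" unfolding z[symmetric] by (simp add: algebra_simps)
  finally have "x2 ^ t * w = x1 * (x3 * w - y)" .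
  then have "x1 dvd x2 ^ t * w" by (metis dvd_triv_left)
  then have "x1 dvd w"
    using prime_elem_x1 x1_not_dvd_x2 prime_elem_dvd_power prime_elem_dvd_mult_iff by blast
  then obtain v where v: "w = x1 * v" ..
  have "F ^ n dvd x1 * v" using v w_def by (metis dvd_triv_left)
  then have "F ^ n dvd v" by (rule Suc.IH)
  moreover have "x1 * y = x1 * (F * v)" using z v by (simp add: ac_simps)
  then have "y = F * v" using x1_neq_0 by simp
  ultimately show ?case by simp
qed simp

lemma cancel_x1_power: "F ^ n dvd x1 ^ j * y \<Longrightarrow> F ^ n dvd y"
  by (induction j) (auto simp: mult.assoc dest: cancel_x1)

lemma cong_mult:
  assumes "F ^ n dvd a - b" "F ^ n dvd c - d"
  shows "F ^ n dvd a * c - b * d"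
proof -
  have "a * c - b * d = (a - b) * c + b * (c - d)" by (simp add: algebra_simps)
  then show ?thesis using assms by (metis dvd_add dvd_mult dvd_mult2)
qed

lemma cong_power: "F ^ n dvd a - b \<Longrightarrow> F ^ n dvd a ^ j - b ^ j"
  by (induction j) (auto intro: cong_mult)

lemma R_p: "R ^ p = F ^ (l * p) * x2 ^ p + x1 ^ (m * p)"
  unfolding R by (simp add: add_power_p power_mult_distrib power_mult)

text \<open>The relation for \<open>G\<close> contains \<open>R\<close> only through
  \<open>R ^ t = (R ^ p) ^ e\<close>. By Frobenius, \<open>R ^ p\<close> agrees with
  \<open>x1 ^ (m * p)\<close> modulo \<open>F ^ (l * p)\<close>, although \<open>R\<close> itself
  agrees with \<open>x1 ^ m\<close> only modulo \<open>F ^ l\<close> in general.\<close>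

lemma G_cong: "F ^ (l * p) dvd G - x1 ^ (m * t - 1)"
proof (rule cancel_x1)
  have "F ^ (l * p) dvd R ^ p - x1 ^ (m * p)" by (simp add: R_p)
  then have "F ^ (l * p) dvd (R ^ p) ^ e - (x1 ^ (m * p)) ^ e" by (rule cong_power)
  then have 1: "F ^ (l * p) dvd R ^ t - x1 ^ (m * t)" by (simp add: t mult.assoc flip: power_mult)
  have "l * p * 1 \<le> l * p * e" using e1 by (rule mult_le_mono2)
  then have "l * p \<le> l * t + 1" by (simp only: t mult_1_right mult.assoc)
  then have 2: "F ^ (l * p) dvd F ^ (l * t + 1)" by (rule le_imp_power_dvd)
  have "Suc (m * t - 1) = m * t" using mt by simp
  then have "x1 * x1 ^ (m * t - 1) = x1 ^ (m * t)" by (metis power_Suc)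
  then have "x1 * (G - x1 ^ (m * t - 1)) = F ^ (l * t + 1) + (R ^ t - x1 ^ (m * t))"
    by (simp add: right_diff_distrib G)
  then show "F ^ (l * p) dvd x1 * (G - x1 ^ (m * t - 1))" using 1 2 by (metis dvd_add)
qed

text \<open>The amount by which the automorphism translates \<open>R\<close>. With it,
  \<open>Q\<close> is the product of the translates \<open>R + i * D\<close> over the prime
  field.\<close>

definition D where "D = F ^ l * G * H"
definition Q where "Q = R ^ p - D ^ (p - 1) * R"
definition Y where "Y = (\<Sum>i<e. (R ^ p) ^ (e - Suc i) * Q ^ i)"
text \<open>Since \<open>Q ^ e - R ^ t = (Q - R ^ p) * Y = - D ^ (p - 1) * R * Y\<close>, division
  of \<open>F ^ (l * t + 1) + Q ^ e\<close> by \<open>G\<close> gives \<open>x1\<close> plus a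
  correction in which one factor \<open>G\<close> of \<open>D ^ (p - 1)\<close> is removed. This is
  possible because \<open>p \<ge> 2\<close>, and it exhibits q1 as a polynomial.\<close>

definition Q1 where "Q1 = x1 - F ^ (l * (p - 1)) * (G ^ (p - 2) * H ^ (p - 1) * R * Y)"

lemma Q1: "G * Q1 = F ^ (l * t + 1) + Q ^ e"
proof -
  have "Q ^ e - (R ^ p) ^ e = (Q - R ^ p) * Y" unfolding Y_def by (rule power_diff_sumr2)
  then have 1: "Q ^ e = R ^ t - D ^ (p - 1) * R * Y"
    by (simp add: Q_def algebra_simps) (simp add: t power_mult)
  have "p - 1 = Suc (p - 2)" using p2 by simp
  then have "G * G ^ (p - 2) = G ^ (p - 1)" by simp
  then have 2: "D ^ (p - 1) = F ^ (l * (p - 1)) * (G * G ^ (p - 2)) * H ^ (p - 1)"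
    by (simp add: D_def power_mult_distrib power_mult)
  have "G * Q1 = x1 * G - D ^ (p - 1) * R * Y"
    unfolding 2 Q1_def by (simp add: algebra_simps)
  then show ?thesis using 1 G by simp
qed

lemma Q1_cong: "F ^ l dvd Q1 - x1"
proof -
  have "l * 1 \<le> l * (p - 1)" using p2 by (intro mult_le_mono2) simp
  then have "F ^ l dvd F ^ (l * (p - 1))" unfolding mult_1_right by (rule le_imp_power_dvd)
  then show ?thesis by (simp add: Q1_def)
qed

lemma G_cong_Q1: "F ^ l dvd G - Q1 ^ (m * t - 1)"
proof -
  have "F ^ l dvd F ^ (l * p)" using p2 by (intro le_imp_power_dvd) simp
  then have "F ^ l dvd G - x1 ^ (m * t - 1)" using G_cong dvd_trans by blast
  moreover have "F ^ l dvd Q1 ^ (m * t - 1) - x1 ^ (m * t - 1)"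
    using Q1_cong by (rule cong_power)
  ultimately have "F ^ l dvd (G - x1 ^ (m * t - 1)) - (Q1 ^ (m * t - 1) - x1 ^ (m * t - 1))"
    by (rule dvd_diff)
  then show ?thesis by simp
qed

lemma alg_cong:
  assumes "a \<in> alg const3 S" and S: "\<And>s. s \<in> S \<Longrightarrow> \<exists>w\<in>alg const3 T. F ^ n dvd s - w"
  shows "\<exists>w\<in>alg const3 T. F ^ n dvd a - w"
  using assms(1)
proof induction
  case (const c) then show ?case by (intro bexI[of _ "const3 c"]) (auto intro: alg.const)
next
  case (gen a)
  then show ?case by (rule S)
next
  case (add a b)
  then obtain v w where "v \<in> alg const3 T" "w \<in> alg const3 T"
    "F ^ n dvd a - v" "F ^ n dvd b - w" by blast
  then show ?case
    by (intro bexI[of _ "v + w"]) (auto intro: alg.add simp: add_diff_add)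
next
  case (mult a b)
  then show ?case using cong_mult alg.mult by metis
next
  case (uminus a)
  then obtain v where v: "v \<in> alg const3 T" "F ^ n dvd a - v" by blast
  have "- a - - v = - (a - v)" by simp
  then show ?case using v by (intro bexI[of _ "- v"]) (auto intro: alg.uminus simp only: dvd_minus_iff)
qed

lemma F_G_cong_Q1:
  assumes "a \<in> alg const3 {F, G}"
  shows "\<exists>w\<in>alg const3 {F, Q1}. F ^ l dvd a - w"
proof (rule alg_cong[OF assms])
  fix s assume "s \<in> {F, G}"
  moreover have "F \<in> alg const3 {F, Q1}" "Q1 ^ (m * t - 1) \<in> alg const3 {F, Q1}"
    by (auto intro: alg.gen c3.alg_power)
  ultimately show "\<exists>w\<in>alg const3 {F, Q1}. F ^ l dvd s - w"
    using G_cong_Q1 by force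
qed

lemma Q_eq: "Q = F ^ (l * p) * (x2 ^ p - (G * H) ^ (p - 1) * x2) + x1 ^ (m * p)
    - F ^ (l * (p - 1)) * ((G * H) ^ (p - 1) * x1 ^ m)"
proof -
  have "D ^ (p - 1) * R = F ^ (l * (p - 1)) * (G * H) ^ (p - 1) * (F ^ l * x2 + x1 ^ m)"
    by (simp add: D_def R power_mult_distrib power_mult mult.assoc)
  also have "\<dots> = F ^ (l * (p - 1) + l) * ((G * H) ^ (p - 1) * x2)
      + F ^ (l * (p - 1)) * ((G * H) ^ (p - 1) * x1 ^ m)"
    by (simp add: power_add algebra_simps)
  also have "l * (p - 1) + l = l * p" using p2 by (simp add: diff_mult_distrib2)
  finally show ?thesis
    unfolding Q_def by (simp add: R_p algebra_simps)
qed

end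

text \<open>Part (i) uses a $w$ obtained from $(gh)^{p-1}$ by replacing $g$ with $q_1^{mt-1}$; the case $w = 0$ describes the image of $\psi$ in part (ii).\<close>

locale action_inv = action p l m t e F R G H
  for p l m t e :: nat and F R G H w :: "'k::field poly poly poly" +
  assumes w_in: "w \<in> alg const3 {F, Q1}" and w: "F ^ l dvd (G * H) ^ (p - 1) - w"
begin

text \<open>In \<open>Q_eq\<close>, consider the terms not visibly divisible by
  \<open>F ^ (l * p)\<close>. \<open>W\<close> is the error made there by replacing
  \<open>x1\<close> with \<open>Q1\<close> and \<open>(G * H) ^ (p - 1)\<close> with
  \<open>w\<close>.\<close>

definition W where
  "W = (x1 ^ (m * p) - Q1 ^ (m * p)) - F ^ (l * (p - 1)) * ((G * H) ^ (p - 1) * x1 ^ m - w * Q1 ^ m)"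

definition \<theta> where
  "\<theta> = Q1 ^ (m * p - 1) - F ^ (l * (p - 1)) * (w * Q1 ^ (m - 1))"

lemma Q1_theta: "Q1 * \<theta> = Q1 ^ (m * p) - F ^ (l * (p - 1)) * (w * Q1 ^ m)"
proof -
  have "Suc (m * p - 1) = m * p" "Suc (m - 1) = m" using m p2 by simp_all
  then have "Q1 * Q1 ^ (m * p - 1) = Q1 ^ (m * p)" "Q1 * Q1 ^ (m - 1) = Q1 ^ m"
    by (metis power_Suc)+
  moreover have "Q1 * \<theta> = Q1 * Q1 ^ (m * p - 1) - F ^ (l * (p - 1)) * (w * (Q1 * Q1 ^ (m - 1)))"
    unfolding \<theta>_def by (simp only: algebra_simps)
  ultimately show ?thesis by (simp only:)
qed

lemma Q_minus_theta: "Q - Q1 * \<theta> = F ^ (l * p) * (x2 ^ p - (G * H) ^ (p - 1) * x2) + W"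
  unfolding Q_eq Q1_theta W_def by (simp add: algebra_simps)

text \<open>The first difference is the p-th power of \<open>x1 ^ m - Q1 ^ m\<close>, which raises
  divisibility by \<open>F ^ l\<close> to divisibility by \<open>F ^ (l * p)\<close>. The second has
  the factor \<open>F ^ (l * (p - 1))\<close>; the missing \<open>F ^ l\<close> comes from
  \<open>Q1_cong\<close> and the choice of \<open>w\<close>.\<close>

lemma W_dvd: "F ^ (l * p) dvd W"
proof -
  have 0: "F ^ l dvd x1 ^ m - Q1 ^ m"
    using cong_power[OF Q1_cong, of m] by (metis dvd_minus_iff minus_diff_eq)
  then have "(F ^ l) ^ p dvd (x1 ^ m - Q1 ^ m) ^ p" by (rule dvd_power_same)
  then have 1: "F ^ (l * p) dvd x1 ^ (m * p) - Q1 ^ (m * p)"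
    by (simp only: diff_power_p power_mult)
  have "F ^ l dvd (G * H) ^ (p - 1) * x1 ^ m - w * Q1 ^ m"
    using cong_mult[OF w 0] .
  then have "F ^ (l * (p - 1)) * F ^ l dvd F ^ (l * (p - 1)) * ((G * H) ^ (p - 1) * x1 ^ m - w * Q1 ^ m)"
    by (rule mult_dvd_mono[OF dvd_refl])
  moreover have "l * (p - 1) + l = l * p" using p2 by (simp add: diff_mult_distrib2)
  ultimately show ?thesis unfolding W_def using 1 by (metis dvd_diff power_add)
qed

definition Q2 where "Q2 = (Q - Q1 * \<theta>) div F ^ (l * p)"

lemma Q2: "F ^ (l * p) * Q2 = Q - Q1 * \<theta>"
proof -
  have "F ^ (l * p) dvd Q - Q1 * \<theta>" unfolding Q_minus_theta using W_dvd by simp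
  then show ?thesis unfolding Q2_def by (rule dvd_mult_div_cancel)
qed

definition Z where "Z = (\<Sum>i<e. Q ^ (e - Suc i) * (Q - Q1 * \<theta>) ^ i)"

text \<open>Both \<open>F ^ (l * t + 1) + Q ^ e\<close> and the change of the power caused by
  passing from \<open>Q\<close> to \<open>Q - Q1 * \<theta>\<close> contain a factor
  \<open>Q1\<close>. Cancelling \<open>Q1\<close> against \<open>F\<close> then shows that
  \<open>Q3\<close> is a polynomial.\<close>

lemma F_Q2_power: "F ^ (l * t) * (F + Q2 ^ e) = Q1 * (G - \<theta> * Z)"
proof -
  have 1: "(Q - Q1 * \<theta>) ^ e - Q ^ e = (Q - Q1 * \<theta> - Q) * Z"
    unfolding Z_def by (rule power_diff_sumr2)
  have "F ^ (l * t) * (F + Q2 ^ e) = F ^ (l * t + 1) + (F ^ (l * p) * Q2) ^ e"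
    by (simp add: t power_mult_distrib algebra_simps flip: power_mult)
  also have "\<dots> = F ^ (l * t + 1) + Q ^ e - Q1 * \<theta> * Z"
    unfolding Q2 using 1 by (simp add: algebra_simps)
  also have "\<dots> = Q1 * (G - \<theta> * Z)" unfolding Q1[symmetric] by (simp add: algebra_simps)
  finally show ?thesis .
qed

lemma cancel_Q1: "F ^ n dvd Q1 * y \<Longrightarrow> F ^ n dvd y"
proof (induction n arbitrary: y)
  case (Suc n)
  have "F dvd Q1 - x1" using Q1_cong l by (metis dvd_power dvd_trans less_le_trans zero_less_one)
  then have "F dvd (Q1 - x1) * y" by (rule dvd_mult2)
  moreover have "F dvd Q1 * y" using Suc.prems by (metis dvd_mult_left power_Suc)
  ultimately have "F dvd Q1 * y - (Q1 - x1) * y" by (intro dvd_diff)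
  then have "F ^ 1 dvd x1 * y" by (simp add: algebra_simps)
  then have "F ^ 1 dvd y" by (rule cancel_x1)
  then obtain z where z: "y = F * z" by auto
  have "F * F ^ n dvd F * (Q1 * z)" using Suc.prems by (simp add: z ac_simps)
  then have "F ^ n dvd Q1 * z" using F_neq_0 by (simp only: dvd_mult_cancel_left) simp
  then have "F ^ n dvd z" by (rule Suc.IH)
  then show ?case using z by simp
qed simp

definition Q3 where "Q3 = (G - \<theta> * Z) div F ^ (l * t)"

lemma Q3: "F ^ (l * t) * Q3 = G - \<theta> * Z"
proof -
  have "F ^ (l * t) dvd G - \<theta> * Z" by (rule cancel_Q1) (simp flip: F_Q2_power)
  then show ?thesis unfolding Q3_def by (rule dvd_mult_div_cancel)
qed

lemma Q1_Q3: "Q1 * Q3 = F + Q2 ^ e"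
proof -
  have "F ^ (l * t) * (Q1 * Q3) = F ^ (l * t) * (F + Q2 ^ e)"
    using F_Q2_power Q3 by (simp add: ac_simps)
  then show ?thesis using F_neq_0 by simp
qed

definition B where "B = alg const3 {Q1, Q2, Q3}"

lemma Qs_in_B [intro]: "Q1 \<in> B" "Q2 \<in> B" "Q3 \<in> B"
  by (auto simp: B_def intro: alg.gen)

lemmas B_closed = alg.add[of _ const3 "{Q1, Q2, Q3}", folded B_def]
  alg.mult[of _ const3 "{Q1, Q2, Q3}", folded B_def]
  alg_diff[of _ const3 "{Q1, Q2, Q3}", folded B_def]
  c3.alg_power[of _ "{Q1, Q2, Q3}", folded B_def]
  c3.alg_sum[of _ _ "{Q1, Q2, Q3}", folded B_def]

text \<open>The memberships build on each other: \<open>F\<close>, then \<open>\<theta>\<close> as a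
  polynomial in \<open>F\<close> and \<open>Q1\<close>, then \<open>Q\<close> by the equation for
  \<open>Q2\<close>, then \<open>G\<close> by the equation for \<open>Q3\<close>.\<close>

lemma F_in_B: "F \<in> B"
proof -
  have "F = Q1 * Q3 - Q2 ^ e" by (simp add: Q1_Q3)
  also have "\<dots> \<in> B" by (auto intro: B_closed)
  finally show ?thesis .
qed

lemma theta_in: "\<theta> \<in> alg const3 {F, Q1}"
  unfolding \<theta>_def
  by (intro alg_diff alg.mult c3.alg_power w_in) (auto intro: alg.gen)

lemma theta_in_B: "\<theta> \<in> B"
  unfolding B_def using theta_in
  by (rule alg_least) (use F_in_B Qs_in_B B_def in auto)

lemma Q_in_B: "Q \<in> B"
proof -
  have "Q = F ^ (l * p) * Q2 + Q1 * \<theta>" by (simp add: Q2)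
  also have "\<dots> \<in> B" by (intro B_closed F_in_B theta_in_B Qs_in_B)
  finally show ?thesis .
qed

lemma G_in_B: "G \<in> B"
proof -
  have "G = F ^ (l * t) * Q3 + \<theta> * Z" by (simp add: Q3)
  also have "\<dots> \<in> B" unfolding Z_def by (intro B_closed F_in_B theta_in_B Qs_in_B Q_in_B)
  finally show ?thesis .
qed

end

section \<open>Homomorphisms on the polynomial ring\<close>

definition khom :: "('k::field poly poly poly \<Rightarrow> 'k rat3) \<Rightarrow> bool" where
  "khom \<phi> \<longleftrightarrow> ring_map \<phi> \<and> (\<forall>c. \<phi> (const3 c) = constK c)"

lemma khom_subst3: "khom (subst3 a b c)"
  by (simp add: khom_def ring_map_subst3)

lemma khom_emb3: "khom emb3"
  by (simp add: khom_def ring_map_emb3 constK_eq)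

lemma khom_alg_eq:
  assumes "khom \<phi>" "khom \<chi>" "a \<in> alg const3 S" "\<And>s. s \<in> S \<Longrightarrow> \<phi> s = \<chi> s"
  shows "\<phi> a = \<chi> a"
  using assms by (intro alg_eqI[of \<phi> \<chi> a const3 S]) (auto simp: khom_def)

lemma khom_evalh: "khom \<phi> \<Longrightarrow> \<phi> (evalh const3 x P) = evalh constK (\<phi> x) P"
  using c3.hom_evalh[of \<phi> x P] by (simp add: khom_def)

lemma khom_evalh2:
  assumes "khom \<phi>"
  shows "\<phi> (evalh (evalh const3 x) y P) = evalh (evalh constK (\<phi> x)) (\<phi> y) P"
proof -
  interpret E: ring_map "evalh const3 x" by (rule c3.evalh_hom)
  show ?thesis using E.hom_evalh[of \<phi> y P] assms by (simp add: khom_evalh) (simp add: khom_def)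
qed

text \<open>A relation satisfied by \<open>x2\<close> survives the substitution of any field element
  for \<open>x2\<close>, so it has infinitely many roots.\<close>

lemma evalh_X2_eq_0:
  assumes "evalh constK X2 P = 0"
  shows "P = 0"
proof -
  have "emb3 (evalh const3 x2 P) = 0"
    using assms by (simp add: khom_evalh[OF khom_emb3] X_eq)
  then have "evalh const3 x2 P = 0" using inj_emb3[of "evalh const3 x2 P" 0] by simp
  then have "evalh constK y P = 0" for y
    using khom_evalh[OF khom_subst3[of 1 y 1], of x2 P] ring_map.zero[OF ring_map_subst3[of 1 y 1]]
    by simp
  then have "map_poly constK P = 0"
    by (intro poly_eq_0_cofinite[of "{}"]) (auto simp: evalh_def)
  then show ?thesis by simp
qed

lemma coeff_pcompose_monom:
  fixes a :: "'a::comm_ring_1 poly"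
  assumes "t > 0"
  shows "coeff (pcompose a (monom c t)) k =
    (if t dvd k then c ^ (k div t) * coeff a (k div t) else 0)"
proof (induction a arbitrary: k)
  case (pCons b a)
  show ?case
  proof (cases "k < t")
    case True
    then have "t dvd k \<longleftrightarrow> k = 0" using dvd_imp_le by fastforce
    with True show ?thesis
      by (cases k) (auto simp: pcompose_pCons coeff_monom_mult coeff_pCons assms)
  next
    case False
    then obtain j where k: "k = j + t" by (metis add.commute le_add_diff_inverse not_less)
    have "coeff (pcompose (pCons b a) (monom c t)) k = c * coeff (pcompose a (monom c t)) j"
      using assms by (simp add: pcompose_pCons coeff_monom_mult coeff_pCons k split: nat.splits)
    then show ?thesis using assms by (auto simp: pCons.IH k)
  qed
qed simp

text \<open>All exponents in the summand \<open>i\<close> are congruent to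
  \<open>n * (p * i)\<close> modulo \<open>p * e\<close>. As \<open>n\<close> is prime to
  \<open>e\<close>, these classes are distinct for \<open>i < e\<close>, and no two summands share
  an exponent.\<close>

lemma monom_pcompose_independent:
  fixes a :: "nat \<Rightarrow> 'k::field poly"
  assumes "p > 0" "e > 0" "c \<noteq> 0" "d \<noteq> 0" "coprime n e"
    and sum0: "(\<Sum>i<e. monom d n ^ (p * i) * pcompose (a i) (monom c (p * e))) = 0"
    and j: "j < e"
  shows "a j = 0"
proof (rule poly_eqI)
  fix k
  \<comment> \<open>The exponent at which the coefficient \<open>k\<close> of \<open>a j\<close>
    appears, undisturbed by the other summands.\<close>
  define r where "r = n * (p * j) + p * e * k"
  have t: "p * e > 0" using assms by simp
  have "coeff (monom d n ^ (p * i) * pcompose (a i) (monom c (p * e))) r =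
      (if i = j then d ^ (p * j) * (c ^ k * coeff (a j) k) else 0)" if i: "i < e" for i
  proof (cases "i = j")
    case True
    then show ?thesis
      using t assms(1,2) by (simp add: monom_power coeff_monom_mult coeff_pcompose_monom[OF t] r_def)
  next
    case False
    have "\<not> p * e dvd r - n * (p * i)" if le: "n * (p * i) \<le> r"
    proof
      assume "p * e dvd r - n * (p * i)"
      then have "int (p * e) dvd int (r - n * (p * i))" by (simp only: of_nat_dvd_iff)
      also have "int (r - n * (p * i)) = int r - int (n * (p * i))" using le by (rule of_nat_diff)
      also have "\<dots> = int (p * e) * int k + int p * (int n * (int j - int i))"
        by (simp add: r_def algebra_simps)
      finally have "int (p * e) dvd int p * (int n * (int j - int i))"
        by (simp only: dvd_add_right_iff[OF dvd_triv_left])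
      then have "int e dvd int n * (int j - int i)" using \<open>p > 0\<close> by simp
      then have "int e dvd int j - int i"
        using \<open>coprime n e\<close> by (simp add: coprime_dvd_mult_right_iff coprime_commute)
      then have "\<bar>int e\<bar> \<le> \<bar>int j - int i\<bar>" using False by (intro dvd_imp_le_int) auto
      then show False using i j by linarith
    qed
    then show ?thesis
      using False t by (auto simp: monom_power coeff_monom_mult coeff_pcompose_monom[OF t])
  qed
  then have "0 = (\<Sum>i<e. if i = j then d ^ (p * j) * (c ^ k * coeff (a j) k) else 0)"
    using arg_cong[OF sum0, of "\<lambda>P. coeff P r"] by (simp add: coeff_sum)
  then show "coeff (a j) k = coeff 0 k"
    using j \<open>c \<noteq> 0\<close> \<open>d \<noteq> 0\<close> by (simp add: sum.delta)
qed

text \<open>\<open>A\<close> contributes nonnegative powers of \<open>x\<close>, the other term only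
  negative ones. Multiplication by \<open>x ^ Suc N\<close> turns this into a comparison of degrees.
  In the application \<open>x\<close> is the image of q1 and \<open>c / x\<close> that of
  q3.\<close>

lemma poly_inverse_independent:
  fixes A B :: "'k::field rat3 poly"
  assumes "c \<noteq> 0" and eq: "\<And>x. x \<noteq> 0 \<Longrightarrow> poly A x + c / x * poly B (c / x) = 0"
  shows "A = 0 \<and> B = 0"
proof -
  define B' where "B' = pcompose B [:0, c:]"
  define N where "N = degree B'"
  have "monom 1 (Suc N) * A + [:c:] * reflect_poly B' = 0"
  proof (rule poly_eq_0_cofinite[of "{0}"])
    fix x :: "'k rat3" assume "x \<notin> {0}"
    then have x: "x \<noteq> 0" by simp
    have "poly B' (inverse x) = poly B (c / x)"
      by (simp add: B'_def poly_pcompose divide_inverse mult.commute)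
    then have "poly (monom 1 (Suc N) * A + [:c:] * reflect_poly B') x
        = x ^ Suc N * (poly A x + c / x * poly B (c / x))"
      using x by (simp add: poly_monom poly_reflect_poly_nz N_def field_simps)
    then show "poly (monom 1 (Suc N) * A + [:c:] * reflect_poly B') x = 0"
      using eq[OF x] by simp
  qed simp
  then have 1: "monom 1 (Suc N) * A = - ([:c:] * reflect_poly B')"
    by (simp add: eq_neg_iff_add_eq_0)
  have A: "A = 0"
  proof (rule ccontr)
    assume "A \<noteq> 0"
    then have "degree (monom 1 (Suc N) * A) = Suc N + degree A"
      by (subst degree_mult_eq) (auto simp: degree_monom_eq)
    moreover have "degree ([:c:] * reflect_poly B') \<le> N"
      using degree_reflect_poly_le[of B'] \<open>c \<noteq> 0\<close> by (simp add: N_def)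
    ultimately show False using 1 by simp
  qed
  then have "reflect_poly B' = 0" using 1 \<open>c \<noteq> 0\<close> by simp
  then have "B' = 0" by simp
  then have "B = 0" unfolding B'_def by (rule pcompose_eq_0) (use \<open>c \<noteq> 0\<close> in simp)
  with A show ?thesis by simp
qed

context action
begin

text \<open>Solving the definitions of \<open>R\<close> and \<open>F\<close> for the images of
  \<open>x2\<close> and \<open>x3\<close> requires only division by powers of \<open>f\<close> and
  by \<open>a\<close>; the image of \<open>G\<close> is then forced by the relation.\<close>

lemma khom_exists:
  assumes "f \<noteq> 0" "a \<noteq> 0" and g: "a * g = f ^ (l * t + 1) + r ^ t"
  shows "\<exists>\<phi>. khom \<phi> \<and> \<phi> x1 = a \<and> \<phi> F = f \<and> \<phi> R = r \<and> \<phi> G = g"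
proof -
  define b where "b = (r - a ^ m) / f ^ l"
  define c where "c = (f + b ^ t) / a"
  interpret S: ring_map "subst3 a b c" by (rule ring_map_subst3)
  have "subst3 a b c F = a * c - b ^ t" by (simp add: F)
  then have F': "subst3 a b c F = f" using assms by (simp add: c_def)
  have "subst3 a b c R = f ^ l * b + a ^ m" using F' by (simp add: R)
  then have R': "subst3 a b c R = r" using assms by (simp add: b_def)
  have "a * subst3 a b c G = f ^ (l * t + 1) + r ^ t"
    using arg_cong[OF G, of "subst3 a b c"] F' R' by simp
  then have "subst3 a b c G = g" using g \<open>a \<noteq> 0\<close> by (metis mult_cancel_left)
  then show ?thesis using F' R' khom_subst3 by (intro exI[of _ "subst3 a b c"]) simp
qed

text \<open>Every k-algebra map to a field that kills $f$ but not $x_1$ has this form; letting $\xi$ and $y$ range over an infinite field replaces computations in the quotient by $f$.\<close>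

definition modF :: "'k rat3 \<Rightarrow> 'k rat3 \<Rightarrow> 'k poly poly poly \<Rightarrow> 'k rat3" where
  "modF \<xi> y = subst3 \<xi> y (y ^ t / \<xi>)"

lemma khom_modF: "khom (modF \<xi> y)"
  by (simp add: modF_def khom_subst3)

lemma ring_map_modF: "ring_map (modF \<xi> y)"
  using khom_modF khom_def by blast

lemma modF_simps:
  assumes "\<xi> \<noteq> 0"
  shows "modF \<xi> y x1 = \<xi>" "modF \<xi> y x2 = y" "modF \<xi> y F = 0"
    "modF \<xi> y G = \<xi> ^ (m * t - 1)" "modF \<xi> y Q1 = \<xi>"
proof -
  interpret S: ring_map "modF \<xi> y" by (rule ring_map_modF)
  show x: "modF \<xi> y x1 = \<xi>" "modF \<xi> y x2 = y" by (simp_all add: modF_def)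
  have "modF \<xi> y x3 = y ^ t / \<xi>" by (simp add: modF_def)
  then show F0: "modF \<xi> y F = 0" using assms x by (simp add: F)
  have eq: "modF \<xi> y a = modF \<xi> y b" if "F ^ n dvd a - b" "n > 0" for a b n
    using S.dvd[OF that(1)] that(2) by (simp add: F0 power_0_left)
  show "modF \<xi> y G = \<xi> ^ (m * t - 1)"
    using eq[OF G_cong] l p_pos x by simp
  show "modF \<xi> y Q1 = \<xi>"
    using eq[OF Q1_cong] l x by simp
qed

lemma G_neq_0: "G \<noteq> 0"
  using modF_simps(4)[of 1 0] ring_map.zero[OF ring_map_modF] by auto

lemma alg_F_decompose:
  assumes "a \<in> alg const3 {F, z}"
  shows "\<exists>P b. b \<in> alg const3 {F, z} \<and> a = evalh const3 z P + F * b"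
proof -
  let ?A = "alg const3 {F, z}"
  interpret E: ring_map "evalh const3 z" by (rule c3.evalh_hom)
  have z: "z \<in> ?A" and Fz: "F \<in> ?A" by (auto intro: alg.gen)
  have "a \<in> {a. \<exists>P b. b \<in> ?A \<and> a = evalh const3 z P + F * b}"
    using assms
  proof (rule c3.alg_module_induct; clarify)
    show "\<exists>P b. b \<in> ?A \<and> 1 = evalh const3 z P + F * b"
      by (intro exI[of _ 1] exI[of _ 0]) (simp add: c3.alg_0)
  next
    fix c P b assume "b \<in> ?A"
    then show "\<exists>P' b'. b' \<in> ?A \<and> const3 c * (evalh const3 z P + F * b) = evalh const3 z P' + F * b'"
      by (intro exI[of _ "[:c:] * P"] exI[of _ "const3 c * b"])
        (simp only: E.mult c3.evalh_const, auto intro: alg.intros simp: algebra_simps)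
  next
    fix P b P' b' assume "b \<in> ?A" "b' \<in> ?A"
    then show "\<exists>P'' b''. b'' \<in> ?A \<and> evalh const3 z P + F * b + (evalh const3 z P' + F * b')
        = evalh const3 z P'' + F * b''"
      by (intro exI[of _ "P + P'"] exI[of _ "b + b'"]) (auto intro: alg.intros simp: algebra_simps)
  next
    fix s P b assume s: "s \<in> {F, z}" and b: "b \<in> ?A"
    show "\<exists>P' b'. b' \<in> ?A \<and> s * (evalh const3 z P + F * b) = evalh const3 z P' + F * b'"
    proof (cases "s = F")
      case True
      then show ?thesis using b z Fz
        by (intro exI[of _ 0] exI[of _ "evalh const3 z P + F * b"])
          (auto intro: alg.intros c3.alg_evalh)
    next
      case False
      then show ?thesis using s b z
        by (intro exI[of _ "pCons 0 P"] exI[of _ "z * b"])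
          (auto intro: alg.intros simp: algebra_simps)
    qed
  qed
  then show ?thesis by blast
qed

text \<open>Divisibility by \<open>F\<close> in the polynomial ring descends to k[F,z]: the part
  \<open>P\<close> free of \<open>F\<close> vanishes at every point of \<open>F = 0\<close>, where
  \<open>z\<close> takes the values \<open>\<xi> ^ n\<close>, so \<open>P\<close> is zero. It is
  needed for \<open>x1\<close>, with \<open>n = 1\<close>, and for \<open>G\<close>, with
  \<open>n = m * t - 1\<close>.\<close>

lemma alg_F_dvd:
  assumes z: "\<And>\<xi>. \<xi> \<noteq> 0 \<Longrightarrow> modF \<xi> 0 z = \<xi> ^ n" and "n \<ge> 1"
    and "a \<in> alg const3 {F, z}" "F ^ j dvd a"
  shows "\<exists>b\<in>alg const3 {F, z}. a = F ^ j * b"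
  using assms(3,4)
proof (induction j arbitrary: a)
  case (Suc j)
  obtain P b where b: "b \<in> alg const3 {F, z}" and a: "a = evalh const3 z P + F * b"
    using alg_F_decompose[OF Suc.prems(1)] by blast
  have "F dvd a" using Suc.prems(2) by (metis dvd_mult_left power_Suc)
  have "pcompose (map_poly constK P) (monom 1 n) = 0"
  proof (rule poly_eq_0_cofinite[of "{0}"])
    fix \<xi> :: "'k rat3" assume "\<xi> \<notin> {0}"
    then have \<xi>: "\<xi> \<noteq> 0" by simp
    interpret S: ring_map "modF \<xi> 0" by (rule ring_map_modF)
    have "modF \<xi> 0 a = 0" using S.dvd[OF \<open>F dvd a\<close>] by (simp add: modF_simps \<xi>)
    then have "evalh constK (\<xi> ^ n) P = 0"
      by (simp add: a modF_simps \<xi> khom_evalh[OF khom_modF] z)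
    then show "poly (pcompose (map_poly constK P) (monom 1 n)) \<xi> = 0"
      by (simp add: evalh_def poly_pcompose poly_monom)
  qed simp
  then have "map_poly constK P = 0"
    by (rule pcompose_eq_0) (use \<open>n \<ge> 1\<close> in \<open>simp add: degree_monom_eq\<close>)
  then have a: "a = F * b" by (simp add: a)
  then have "F ^ j dvd b" using Suc.prems(2) F_neq_0 by simp
  then show ?case using Suc.IH[OF b] a by (auto simp: mult.assoc)
qed simp

section \<open>Approximation by elements of k[f,x1] modulo powers of f\<close>

abbreviation approx where "approx n a \<equiv> \<exists>\<kappa>\<in>alg const3 {F, x1}. F ^ n dvd a - \<kappa>"

lemma approx_mono: "approx n a \<Longrightarrow> j \<le> n \<Longrightarrow> approx j a"
  using le_imp_power_dvd dvd_trans by blast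

lemma approx_mult_power: "approx n a \<Longrightarrow> approx (j + n) (F ^ j * a)"
proof (elim bexE)
  fix \<kappa> assume "\<kappa> \<in> alg const3 {F, x1}" "F ^ n dvd a - \<kappa>"
  then show ?thesis
    by (intro bexI[of _ "F ^ j * \<kappa>"])
      (auto intro!: alg.mult c3.alg_power intro: alg.gen simp: power_add simp flip: right_diff_distrib)
qed

lemma approx_gen: "a \<in> {F, x1} \<Longrightarrow> approx n a"
  by (rule bexI[of _ a]) (auto intro: alg.gen)

lemma approx_G: "approx (l * p) G"
  using G_cong by (intro bexI[of _ "x1 ^ (m * t - 1)"]) (auto intro: alg.gen c3.alg_power)

lemma approx_H: "approx (l * p) H"
  by (rule alg_cong[OF H]) (use approx_G approx_gen in auto)

lemma approx_R: "approx l R"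
  by (intro bexI[of _ "x1 ^ m"]) (auto intro: alg.gen c3.alg_power simp: R)

text \<open>\<open>R\<close> is approximated only modulo \<open>F ^ l\<close>, but it enters
  \<open>Q1\<close> with the factor \<open>F ^ (l * (p - 1))\<close>, which supplies the remaining
  order.\<close>

lemma approx_Q1: "approx (l * p) Q1"
proof -
  let ?M = "G ^ (p - 2) * H ^ (p - 1) * R * Y"
  have "?M \<in> alg const3 {F, G, H, R}"
    unfolding Y_def Q_def D_def
    by (intro alg.mult c3.alg_power c3.alg_sum alg_diff) (auto intro: alg.gen)
  moreover have "approx l G" "approx l H" using approx_mono[OF approx_G, of l] approx_mono[OF approx_H, of l] p_pos by auto
  ultimately have "approx l ?M"
    by (elim alg_cong) (use approx_gen approx_R in auto)
  then have M: "approx (l * (p - 1) + l) (F ^ (l * (p - 1)) * ?M)" by (rule approx_mult_power)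
  have "l * (p - 1) + l = l * p" using p_pos by (simp add: diff_mult_distrib2)
  then have M: "approx (l * p) (F ^ (l * (p - 1)) * ?M)" using M by simp
  show ?thesis unfolding Q1_def
    by (rule alg_cong[of _ "{x1, F ^ (l * (p - 1)) * ?M}"])
      (use M approx_gen in \<open>auto intro: alg_diff alg.gen\<close>)
qed

lemma approx_power_p: "approx n a \<Longrightarrow> approx (n * p) (a ^ p)"
proof (elim bexE)
  fix \<kappa> assume "\<kappa> \<in> alg const3 {F, x1}" "F ^ n dvd a - \<kappa>"
  then show ?thesis
    by (intro bexI[of _ "\<kappa> ^ p"])
      (auto intro: c3.alg_power dvd_power_same simp: power_mult simp flip: diff_power_p)
qed

end

context action_inv
begin

text \<open>The order is one more than that of the power dividing \<open>W\<close>, so that the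
  quotient \<open>W / F ^ (l * p)\<close> is still controlled modulo \<open>F\<close>. The extra
  order comes from \<open>l * p * p \<ge> l * p * 2\<close> in the p-th power and from
  \<open>l * (p - 1) > 0\<close> in the other term.\<close>

lemma approx_W: "approx (l * p + 1) W"
proof -
  have w: "approx (l * p) w"
    by (rule alg_cong[OF w_in]) (use approx_Q1 approx_gen in auto)
  have "approx (l * p) (x1 ^ m - Q1 ^ m)"
    by (rule alg_cong[of _ "{x1, Q1}"])
      (use approx_Q1 approx_gen in \<open>auto intro: alg_diff c3.alg_power alg.gen\<close>)
  then have "approx (l * p * p) ((x1 ^ m - Q1 ^ m) ^ p)" by (rule approx_power_p)
  moreover have "l * p * 2 \<le> l * p * p" using p2 by (rule mult_le_mono2)
  moreover have lp: "l * p > 0" using l p_pos by simp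
  ultimately have "approx (l * p + 1) ((x1 ^ m - Q1 ^ m) ^ p)" by (elim approx_mono) linarith
  then have 1: "approx (l * p + 1) (x1 ^ (m * p) - Q1 ^ (m * p))"
    by (simp only: diff_power_p power_mult)
  have "approx (l * p) ((G * H) ^ (p - 1) * x1 ^ m - w * Q1 ^ m)"
    by (rule alg_cong[of _ "{x1, Q1, G, H, w}"])
      (use w approx_Q1 approx_G approx_H approx_gen in \<open>auto intro!: alg_diff c3.alg_power alg.mult intro: alg.gen\<close>)
  then have "approx (l * (p - 1) + l * p) (F ^ (l * (p - 1)) * ((G * H) ^ (p - 1) * x1 ^ m - w * Q1 ^ m))"
    by (rule approx_mult_power)
  moreover have "l * (p - 1) > 0" using l p2 by simp
  ultimately have 2: "approx (l * p + 1) (F ^ (l * (p - 1)) * ((G * H) ^ (p - 1) * x1 ^ m - w * Q1 ^ m))"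
    by (elim approx_mono) linarith
  show ?thesis unfolding W_def
    by (rule alg_cong[of _ "{x1 ^ (m * p) - Q1 ^ (m * p),
        F ^ (l * (p - 1)) * ((G * H) ^ (p - 1) * x1 ^ m - w * Q1 ^ m)}"])
      (use 1 2 in \<open>auto intro: alg_diff alg.gen\<close>)
qed

text \<open>The coefficients do not depend on \<open>y\<close>, because they come from elements of
  k[F,G] and k[F,x1], and \<open>modF\<close> maps \<open>F\<close>, \<open>G\<close>,
  \<open>x1\<close> to expressions in \<open>\<xi>\<close> alone. The witnesses may therefore be
  read off at \<open>y = 0\<close>.\<close>

lemma Q2_shape:
  "\<exists>c1 c0. \<forall>\<xi> y. \<xi> \<noteq> 0 \<longrightarrow> modF \<xi> y Q2 = y ^ p + c1 \<xi> * y + c0 \<xi>"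
proof -
  obtain \<kappa> where \<kappa>: "\<kappa> \<in> alg const3 {F, x1}" and dvd: "F ^ (l * p + 1) dvd W - \<kappa>"
    using approx_W by blast
  from dvd obtain a where a: "W - \<kappa> = F ^ (l * p + 1) * a" ..
  have "F ^ (l * p) dvd W - F ^ (l * p) * (F * a)" using W_dvd by simp
  also have "W - F ^ (l * p) * (F * a) = \<kappa>" using a by (simp add: algebra_simps)
  finally obtain \<kappa>' where \<kappa>': "\<kappa>' \<in> alg const3 {F, x1}" "\<kappa> = F ^ (l * p) * \<kappa>'"
    using alg_F_dvd[of x1 1 \<kappa> "l * p"] \<kappa> modF_simps(1) by auto
  have "F ^ (l * p) * Q2 = F ^ (l * p) * (x2 ^ p - (G * H) ^ (p - 1) * x2 + \<kappa>' + F * a)"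
    using a \<kappa>'(2) unfolding Q2 Q_minus_theta by (simp add: algebra_simps)
  then have Q2': "Q2 = x2 ^ p - (G * H) ^ (p - 1) * x2 + \<kappa>' + F * a" using F_neq_0 by simp
  have "modF \<xi> y Q2 = y ^ p + - modF \<xi> 0 ((G * H) ^ (p - 1)) * y + modF \<xi> 0 \<kappa>'"
    if "\<xi> \<noteq> 0" for \<xi> y
  proof -
    interpret S: ring_map "modF \<xi> y" by (rule ring_map_modF)
    have "modF \<xi> y \<kappa>' = modF \<xi> 0 \<kappa>'"
      using modF_simps[OF that] by (intro khom_alg_eq[OF khom_modF khom_modF \<kappa>'(1)]) auto
    moreover have "(G * H) ^ (p - 1) \<in> alg const3 {F, G}"
      by (rule c3.alg_power, rule alg.mult, rule alg.gen, simp, rule H)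
    then have "modF \<xi> y ((G * H) ^ (p - 1)) = modF \<xi> 0 ((G * H) ^ (p - 1))"
      using modF_simps[OF that] by (elim khom_alg_eq[OF khom_modF khom_modF]) auto
    moreover have "modF \<xi> y Q2 = y ^ p - modF \<xi> y ((G * H) ^ (p - 1)) * y + modF \<xi> y \<kappa>'"
      unfolding Q2' using modF_simps[OF that, of y] by (simp only: S.add S.diff S.mult S.power) simp
    ultimately show ?thesis by simp
  qed
  then show ?thesis
    by (intro exI[of _ "\<lambda>\<xi>. - modF \<xi> 0 ((G * H) ^ (p - 1))"] exI[of _ "\<lambda>\<xi>. modF \<xi> 0 \<kappa>'"] allI impI)
qed

end

section \<open>The algebra generated by the three invariants\<close>

context action_inv
begin

section \<open>Reduction modulo f\<close>

interpretation EQ2: ring_map "evalh const3 Q2" by (rule c3.evalh_hom)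
interpretation E1: ring_map "evalh (evalh const3 Q2) Q1" by (rule EQ2.evalh_hom)
interpretation E3: ring_map "evalh (evalh const3 Q2) Q3" by (rule EQ2.evalh_hom)

lemma evalh_Q2_in_B: "evalh (evalh const3 Q2) x V \<in> B" if "x \<in> B"
proof (induction V)
  case (pCons v V)
  have "evalh const3 Q2 v \<in> B"
    unfolding B_def by (rule c3.alg_evalh) (auto intro: alg.gen)
  then show ?case using pCons that by (auto intro: B_closed)
qed (simp add: B_def c3.alg_0)

lemma Q1_E3: "\<exists>U W b. b \<in> B \<and> Q1 * (Q3 * evalh (evalh const3 Q2) Q3 V) =
    evalh (evalh const3 Q2) Q1 U + Q3 * evalh (evalh const3 Q2) Q3 W + F * b"
proof (cases V)
  case (pCons v V')
  have "Q1 * (Q3 * evalh (evalh const3 Q2) Q3 V)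
      = Q2 ^ e * (evalh const3 Q2 v + Q3 * evalh (evalh const3 Q2) Q3 V') + F * evalh (evalh const3 Q2) Q3 V"
    using Q1_Q3 by (simp add: pCons algebra_simps flip: mult.assoc)
  also have "\<dots> = evalh (evalh const3 Q2) Q1 [:[:0, 1:] ^ e * v:]
      + Q3 * evalh (evalh const3 Q2) Q3 ([:[:0, 1:] ^ e:] * V') + F * evalh (evalh const3 Q2) Q3 V"
    by (simp only: E3.mult EQ2.evalh_const EQ2.mult EQ2.power c3.evalh_pCons) (simp add: algebra_simps)
  finally show ?thesis using evalh_Q2_in_B[of Q3 V] by blast
qed

lemma Q3_E1: "\<exists>U W b. b \<in> B \<and> Q3 * evalh (evalh const3 Q2) Q1 V =
    evalh (evalh const3 Q2) Q1 U + Q3 * evalh (evalh const3 Q2) Q3 W + F * b"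
proof (cases V)
  case (pCons v V')
  have "Q3 * evalh (evalh const3 Q2) Q1 V
      = Q3 * evalh const3 Q2 v + (Q1 * Q3) * evalh (evalh const3 Q2) Q1 V'"
    by (simp add: pCons algebra_simps)
  also have "\<dots> = Q2 ^ e * evalh (evalh const3 Q2) Q1 V' + Q3 * evalh const3 Q2 v
      + F * evalh (evalh const3 Q2) Q1 V'"
    unfolding Q1_Q3 by (simp add: algebra_simps)
  also have "\<dots> = evalh (evalh const3 Q2) Q1 ([:[:0, 1:] ^ e:] * V')
      + Q3 * evalh (evalh const3 Q2) Q3 [:v:] + F * evalh (evalh const3 Q2) Q1 V'"
    by (simp only: E1.mult EQ2.evalh_const EQ2.mult EQ2.power c3.evalh_pCons) simp
  finally show ?thesis using evalh_Q2_in_B[of Q1 V'] by blast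
qed

text \<open>Modulo \<open>F\<close> one has \<open>Q1 * Q3 = Q2 ^ e\<close>, which removes every
  product of \<open>Q1\<close> and \<open>Q3\<close>. The separate factor \<open>Q3\<close> keeps
  the two remaining families of monomials disjoint.\<close>

lemma B_decompose:
  assumes "a \<in> B"
  shows "\<exists>U V b. b \<in> B \<and>
    a = evalh (evalh const3 Q2) Q1 U + Q3 * evalh (evalh const3 Q2) Q3 V + F * b"
proof -
  define T where "T = {a. \<exists>U V b. b \<in> B \<and>
    a = evalh (evalh const3 Q2) Q1 U + Q3 * evalh (evalh const3 Q2) Q3 V + F * b}"
  have T_I: "evalh (evalh const3 Q2) Q1 U + Q3 * evalh (evalh const3 Q2) Q3 V + F * b \<in> T"
    if "b \<in> B" for U V b
    using that unfolding T_def by blast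
  have T_E: "\<exists>U V b. b \<in> B \<and>
      x = evalh (evalh const3 Q2) Q1 U + Q3 * evalh (evalh const3 Q2) Q3 V + F * b" if "x \<in> T" for x
    using that unfolding T_def by (rule CollectD)
  have 0: "0 \<in> B" by (simp add: B_def c3.alg_0)
  have plus: "x + y \<in> T" if "x \<in> T" "y \<in> T" for x y
  proof -
    obtain U V b U' V' b' where "b \<in> B" "b' \<in> B"
      and x: "x = evalh (evalh const3 Q2) Q1 U + Q3 * evalh (evalh const3 Q2) Q3 V + F * b"
      and y: "y = evalh (evalh const3 Q2) Q1 U' + Q3 * evalh (evalh const3 Q2) Q3 V' + F * b'"
      using T_E[OF \<open>x \<in> T\<close>] T_E[OF \<open>y \<in> T\<close>] by blast
    then have "b + b' \<in> B" by (intro B_closed)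
    from T_I[OF this, of "U + U'" "V + V'"] show ?thesis by (simp add: x y algebra_simps)
  qed
  have EQ2: "evalh const3 Q2 c * x \<in> T" if "x \<in> T" for c x
  proof -
    obtain U V b where "b \<in> B"
      and x: "x = evalh (evalh const3 Q2) Q1 U + Q3 * evalh (evalh const3 Q2) Q3 V + F * b"
      using T_E[OF \<open>x \<in> T\<close>] by blast
    moreover have "evalh const3 Q2 c \<in> B"
      unfolding B_def by (rule c3.alg_evalh) (auto intro: alg.gen)
    ultimately have "evalh const3 Q2 c * b \<in> B" by (intro B_closed)
    from T_I[OF this, of "[:c:] * U" "[:c:] * V"] show ?thesis
      unfolding E1.mult E3.mult EQ2.evalh_const by (simp add: x algebra_simps)
  qed
  have "a \<in> T"
    using assms unfolding B_def
  proof (rule c3.alg_module_induct)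
    show "1 \<in> T" using T_I[OF 0, of 1 0] by simp
  next
    fix c x assume "x \<in> T"
    then show "const3 c * x \<in> T" using EQ2[of x "[:c:]"] by (simp only: c3.evalh_const)
  next
    fix s x assume s: "s \<in> {Q1, Q2, Q3}" and x: "x \<in> T"
    obtain U V b where b: "b \<in> B"
      and x': "x = evalh (evalh const3 Q2) Q1 U + Q3 * evalh (evalh const3 Q2) Q3 V + F * b"
      using T_E[OF x] by blast
    from s consider "s = Q1" | "s = Q2" | "s = Q3" by blast
    then show "s * x \<in> T"
    proof cases
      case 1
      have "Q1 * (Q3 * evalh (evalh const3 Q2) Q3 V) \<in> T"
        using Q1_E3[of V] unfolding T_def by blast
      moreover have "evalh (evalh const3 Q2) Q1 (pCons 0 U)
          + Q3 * evalh (evalh const3 Q2) Q3 0 + F * (Q1 * b) \<in> T"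
        by (intro T_I B_closed b Qs_in_B)
      ultimately have "Q1 * (Q3 * evalh (evalh const3 Q2) Q3 V) +
          (evalh (evalh const3 Q2) Q1 (pCons 0 U) + Q3 * evalh (evalh const3 Q2) Q3 0 + F * (Q1 * b)) \<in> T"
        by (rule plus)
      then show ?thesis by (simp add: 1 x' algebra_simps)
    next
      case 2
      have "s = evalh const3 Q2 [:0, 1:]" by (simp add: 2)
      then show ?thesis using EQ2[OF x] by (simp only:)
    next
      case 3
      have "Q3 * evalh (evalh const3 Q2) Q1 U \<in> T"
        using Q3_E1[of U] unfolding T_def by blast
      moreover have "evalh (evalh const3 Q2) Q1 0
          + Q3 * evalh (evalh const3 Q2) Q3 (pCons 0 V) + F * (Q3 * b) \<in> T"
        by (intro T_I B_closed b Qs_in_B)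
      ultimately have "Q3 * evalh (evalh const3 Q2) Q1 U +
          (evalh (evalh const3 Q2) Q1 0 + Q3 * evalh (evalh const3 Q2) Q3 (pCons 0 V) + F * (Q3 * b)) \<in> T"
        by (rule plus)
      then show ?thesis by (simp add: 3 x' algebra_simps)
    qed
  qed (rule plus)
  then show ?thesis unfolding T_def by blast
qed

text \<open>For fixed \<open>\<xi>\<close> the image of \<open>Q2\<close> is a polynomial of degree
  \<open>p\<close> in \<open>y\<close>, and composition with it is injective. Hence it can be
  replaced by a free parameter \<open>\<eta>\<close>, while \<open>Q1\<close> and \<open>Q3\<close>
  become \<open>\<xi>\<close> and \<open>\<eta> ^ e / \<xi>\<close>. Varying \<open>\<xi>\<close>
  separates their powers, and varying \<open>\<eta>\<close> kills the coefficients.\<close>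

lemma B_modF_independent:
  assumes "F dvd evalh (evalh const3 Q2) Q1 U + Q3 * evalh (evalh const3 Q2) Q3 V"
  shows "U = 0 \<and> V = 0"
proof -
  obtain c1 c0 where shape: "modF \<xi> y Q2 = y ^ p + c1 \<xi> * y + c0 \<xi>" if "\<xi> \<noteq> 0" for \<xi> y
    using Q2_shape by blast
  have main: "evalh (evalh constK \<eta>) \<xi> U + \<eta> ^ e / \<xi> * evalh (evalh constK \<eta>) (\<eta> ^ e / \<xi>) V = 0"
    if \<xi>: "\<xi> \<noteq> 0" for \<xi> \<eta>
  proof -
    define d where "d = monom 1 p + [:c0 \<xi>, c1 \<xi>:]"
    have "degree d = p"
      unfolding d_def using p2
      by (subst degree_add_eq_left) (auto simp: degree_monom_eq intro: le_less_trans[OF degree_pCons_le])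
    interpret M: ring_map "map_poly (constK :: 'k \<Rightarrow> _)" by (rule cK.map_poly_hom)
    define w where "w = evalh (map_poly constK) [:\<xi>:] U
      + monom (1 / \<xi>) e * evalh (map_poly constK) (monom (1 / \<xi>) e) V"
    have poly_w: "poly w \<eta> = evalh (evalh constK \<eta>) \<xi> U
        + \<eta> ^ e / \<xi> * evalh (evalh constK \<eta>) (\<eta> ^ e / \<xi>) V" for \<eta>
      using M.hom_evalh[OF ring_map_poly[of \<eta>]]
      by (simp add: w_def poly_monom evalh_def[of constK, abs_def])
    have "pcompose w d = 0"
    proof (rule poly_eq_0_cofinite[of "{}"])
      fix y
      interpret S: ring_map "modF \<xi> y" by (rule ring_map_modF)
      have dy: "poly d y = modF \<xi> y Q2" by (simp add: d_def poly_monom shape[OF \<xi>] algebra_simps)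
      have "modF \<xi> y (Q1 * Q3) = modF \<xi> y Q2 ^ e"
        unfolding Q1_Q3 using modF_simps(3)[OF \<xi>] by simp
      then have q3: "modF \<xi> y Q3 = modF \<xi> y Q2 ^ e / \<xi>"
        using modF_simps(5)[OF \<xi>] \<xi> by (simp add: field_simps)
      have "modF \<xi> y (evalh (evalh const3 Q2) Q1 U + Q3 * evalh (evalh const3 Q2) Q3 V) = 0"
        using S.dvd[OF assms] modF_simps(3)[OF \<xi>] by simp
      then have "poly w (poly d y) = 0"
        unfolding poly_w dy using modF_simps(5)[OF \<xi>]
        by (simp add: khom_evalh2[OF khom_modF] q3)
      then show "poly (pcompose w d) y = 0" by (simp add: poly_pcompose)
    qed simp
    then have "w = 0" by (rule pcompose_eq_0) (use \<open>degree d = p\<close> p2 in simp)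
    then show ?thesis using poly_w[of \<eta>] by simp
  qed
  have coeffs: "map_poly (evalh constK \<eta>) U = 0 \<and> map_poly (evalh constK \<eta>) V = 0"
    if "\<eta> \<noteq> 0" for \<eta>
    using that main[of _ \<eta>] unfolding evalh_def[of "evalh constK \<eta>"]
    by (intro poly_inverse_independent[of "\<eta> ^ e"]) auto
  have "P = 0" if P: "\<And>\<eta>. \<eta> \<noteq> 0 \<Longrightarrow> map_poly (evalh constK \<eta>) P = 0" for P :: "'k poly poly"
  proof (rule poly_eqI)
    fix n
    have "map_poly constK (coeff P n) = 0"
    proof (rule poly_eq_0_cofinite[of "{0}"])
      fix \<eta> :: "'k rat3" assume "\<eta> \<notin> {0}"
      then have "map_poly (evalh constK \<eta>) P = 0" using P by simp
      then have "coeff (map_poly (evalh constK \<eta>) P) n = 0" by simp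
      then show "poly (map_poly constK (coeff P n)) \<eta> = 0"
        by (simp add: ring_map.coeff_map[OF cK.evalh_hom]) (simp add: evalh_def)
    qed simp
    then show "coeff P n = coeff 0 n" by simp
  qed
  then show ?thesis using coeffs by blast
qed

lemma F_mult_in_B: "F * a \<in> B \<Longrightarrow> a \<in> B"
proof -
  assume "F * a \<in> B"
  then obtain U V b where b: "b \<in> B"
    and a: "F * a = evalh (evalh const3 Q2) Q1 U + Q3 * evalh (evalh const3 Q2) Q3 V + F * b"
    using B_decompose by blast
  have "evalh (evalh const3 Q2) Q1 U + Q3 * evalh (evalh const3 Q2) Q3 V = F * (a - b)"
    using a by (simp add: algebra_simps)
  then have "U = 0 \<and> V = 0" by (intro B_modF_independent) simp
  then have "F * a = F * b" using a by simp
  then show "a \<in> B" using F_neq_0 b by simp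
qed

lemma F_power_mult_in_B: "F ^ n * a \<in> B \<Longrightarrow> a \<in> B"
  by (induction n) (auto simp: mult.assoc dest: F_mult_in_B)

section \<open>Reduction modulo g after inverting f\<close>

definition B0 where "B0 = alg const3 {F, G, Q, Q1}"

lemma B0_gens: "F \<in> B0" "G \<in> B0" "Q \<in> B0" "Q1 \<in> B0"
  by (auto simp: B0_def intro: alg.gen)

lemmas B0_closed = alg.add[of _ const3 "{F, G, Q, Q1}", folded B0_def]
  alg.mult[of _ const3 "{F, G, Q, Q1}", folded B0_def]
  alg_diff[of _ const3 "{F, G, Q, Q1}", folded B0_def]
  c3.alg_power[of _ "{F, G, Q, Q1}", folded B0_def]
  c3.alg_sum[of _ _ "{F, G, Q, Q1}", folded B0_def]
  c3.alg_evalh[of _ "{F, G, Q, Q1}", folded B0_def]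

lemma B0_subset_B: "B0 \<subseteq> B"
  unfolding B0_def B_def
  by (rule subsetI, erule alg_least)
    (use F_in_B G_in_B Q_in_B Qs_in_B in \<open>auto simp: B_def\<close>)

lemma B_in_B0_localized:
  assumes "a \<in> B" shows "\<exists>n. F ^ n * a \<in> B0"
  unfolding B0_def
proof (rule c3.alg_clear_denominator)
  show "a \<in> alg const3 {Q1, Q2, Q3}" using assms by (simp add: B_def)
  show "F \<in> alg const3 {F, G, Q, Q1}" by (rule alg.gen) simp
  have \<theta>: "\<theta> \<in> B0"
    unfolding B0_def using theta_in by (rule alg_mono[rotated]) auto
  have "F ^ 0 * Q1 \<in> B0" using B0_gens by simp
  moreover have "F ^ (l * p) * Q2 \<in> B0" unfolding Q2
    by (intro B0_closed B0_gens \<theta>)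
  moreover have "F ^ (l * t) * Q3 \<in> B0" unfolding Q3 Z_def
    by (intro B0_closed B0_gens \<theta>)
  ultimately show "\<exists>n. F ^ n * s \<in> alg const3 {F, G, Q, Q1}" if "s \<in> {Q1, Q2, Q3}" for s
    using that unfolding B0_def by blast
qed

interpretation EF: ring_map "evalh const3 F" by (rule c3.evalh_hom)
interpretation EF1: ring_map "evalh (evalh const3 F) Q1" by (rule EF.evalh_hom)

text \<open>Modulo \<open>G\<close> the relation for \<open>Q1\<close> turns \<open>Q ^ e\<close>
  into \<open>- (F ^ (l * t + 1))\<close>, so powers of \<open>Q\<close> below \<open>e\<close>
  suffice.\<close>

lemma B0_decompose:
  assumes "a \<in> B0"
  shows "\<exists>E b. b \<in> B0 \<and> a = (\<Sum>i<e. Q ^ i * evalh (evalh const3 F) Q1 (E i)) + G * b"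
proof -
  define T where "T = {a. \<exists>E b. b \<in> B0 \<and>
    a = (\<Sum>i<e. Q ^ i * evalh (evalh const3 F) Q1 (E i)) + G * b}"
  have T_I: "(\<Sum>i<e. Q ^ i * evalh (evalh const3 F) Q1 (E i)) + G * b \<in> T"
    if "b \<in> B0" for E b
    using that unfolding T_def by blast
  have T_E: "\<exists>E b. b \<in> B0 \<and>
      x = (\<Sum>i<e. Q ^ i * evalh (evalh const3 F) Q1 (E i)) + G * b" if "x \<in> T" for x
    using that unfolding T_def by (rule CollectD)
  have 0: "0 \<in> B0" by (simp add: B0_def c3.alg_0)
  obtain d where d: "e = Suc d" using e1 by (cases e) auto
  have EE: "evalh (evalh const3 F) Q1 u * x \<in> T" if u: "evalh (evalh const3 F) Q1 u \<in> B0" and "x \<in> T" for u x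
  proof -
    obtain E b where "b \<in> B0"
      and x: "x = (\<Sum>i<e. Q ^ i * evalh (evalh const3 F) Q1 (E i)) + G * b"
      using T_E[OF \<open>x \<in> T\<close>] by blast
    with u have "evalh (evalh const3 F) Q1 u * b \<in> B0" by (intro B0_closed)
    from T_I[OF this, of "\<lambda>i. u * E i"] show ?thesis
      by (simp add: x sum_distrib_left algebra_simps)
  qed
  have "a \<in> T"
    using assms unfolding B0_def
  proof (rule c3.alg_module_induct)
    have "(\<Sum>i<e. Q ^ i * evalh (evalh const3 F) Q1 (if i = 0 then 1 else 0))
        = (\<Sum>i<e. if i = 0 then 1 else 0)"
      by (rule sum.cong) auto
    also have "\<dots> = 1" using e1 by (simp add: sum.delta)
    finally show "1 \<in> T" using T_I[OF 0, of "\<lambda>i. if i = 0 then 1 else 0"] by simp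
  next
    fix c x assume x: "x \<in> T"
    have "evalh (evalh const3 F) Q1 [:[:c:]:] = const3 c"
      by (simp only: EF.evalh_const c3.evalh_const)
    then show "const3 c * x \<in> T"
      using EE[of "[:[:c:]:]", OF _ x] by (simp add: B0_def alg.const)
  next
    fix x y assume xy: "x \<in> T" "y \<in> T"
    obtain E b E' b' where "b \<in> B0" "b' \<in> B0"
      and x: "x = (\<Sum>i<e. Q ^ i * evalh (evalh const3 F) Q1 (E i)) + G * b"
      and y: "y = (\<Sum>i<e. Q ^ i * evalh (evalh const3 F) Q1 (E' i)) + G * b'"
      using T_E[OF xy(1)] T_E[OF xy(2)] by blast
    then have "b + b' \<in> B0" by (intro B0_closed)
    from T_I[OF this, of "\<lambda>i. E i + E' i"] show "x + y \<in> T"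
      by (simp add: x y algebra_simps sum.distrib)
  next
    fix s x assume s: "s \<in> {F, G, Q, Q1}" and xT: "x \<in> T"
    obtain E b where b: "b \<in> B0"
      and x: "x = (\<Sum>i<e. Q ^ i * evalh (evalh const3 F) Q1 (E i)) + G * b"
      using T_E[OF xT] by blast
    have EB: "evalh (evalh const3 F) Q1 u \<in> B0" for u
    proof (induction u)
      case (pCons v u)
      have "evalh const3 F v \<in> B0" by (intro B0_closed B0_gens)
      then show ?case using pCons B0_gens by (auto intro: B0_closed)
    qed (simp add: 0)
    have xB: "x \<in> B0" unfolding x by (intro B0_closed B0_gens b EB)
    from s consider "s = F" | "s = G" | "s = Q1" | "s = Q" by blast
    then show "s * x \<in> T"
    proof cases
      case 1
      have "evalh (evalh const3 F) Q1 [:[:0, 1:]:] = F"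
        by (simp only: EF.evalh_const) simp
      then show ?thesis using EE[OF EB xT, of "[:[:0, 1:]:]"] 1 by simp
    next
      case 2
      then show ?thesis using T_I[OF xB, of "\<lambda>_. 0"] by simp
    next
      case 3
      have "evalh (evalh const3 F) Q1 [:0, 1:] = Q1" by simp
      then show ?thesis using EE[OF EB xT, of "[:0, 1:]"] 3 by simp
    next
      case 4
      define u where "u = evalh (evalh const3 F) Q1 (E d)"
      \<comment> \<open>Multiplication by \<open>Q\<close> shifts the coefficients by one place. The
        overflow \<open>Q ^ e * u\<close> reduces to \<open>- (F ^ (l * t + 1) * u)\<close> modulo
        \<open>G\<close> and fills the vacated place 0.\<close>
      define E' where "E' = (\<lambda>i. if i = 0 then - ([:[:0, 1:] ^ (l * t + 1):] * E d) else E (i - 1))"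
      have b': "Q1 * u + Q * b \<in> B0" unfolding u_def by (intro B0_closed B0_gens EB b)
      have "Q ^ Suc d = G * Q1 - F ^ (l * t + 1)" using Q1 by (simp add: d)
      then have Qd: "Q * Q ^ d * u = G * (Q1 * u) - F ^ (l * t + 1) * u"
        by (simp only: power_Suc[symmetric] left_diff_distrib mult.assoc)
      have "Q * x = (\<Sum>i<d. Q ^ Suc i * evalh (evalh const3 F) Q1 (E i)) + Q * Q ^ d * u + G * (Q * b)"
        by (simp add: x d u_def sum_distrib_left algebra_simps)
      also have "\<dots> = (- (F ^ (l * t + 1) * u) + (\<Sum>i<d. Q ^ Suc i * evalh (evalh const3 F) Q1 (E i)))
          + G * (Q1 * u + Q * b)"
        unfolding Qd by (simp add: algebra_simps)
      also have "- (F ^ (l * t + 1) * u) = evalh (evalh const3 F) Q1 (E' 0)"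
        unfolding E'_def if_P[OF refl] EF1.uminus EF1.mult EF.evalh_const EF.power u_def by simp
      also have "\<dots> + (\<Sum>i<d. Q ^ Suc i * evalh (evalh const3 F) Q1 (E i))
          = (\<Sum>i<e. Q ^ i * evalh (evalh const3 F) Q1 (E' i))"
        by (simp add: d sum.lessThan_Suc_shift E'_def del: sum.lessThan_Suc)
      finally show ?thesis using T_I[OF b', of E'] 4 by simp
    qed
  qed
  then show ?thesis unfolding T_def by blast
qed

text \<open>The shift $c$ is nonzero only for $p = 2$.\<close>

lemma khom_modG:
  fixes f r :: "'k rat3"
  assumes "f \<noteq> 0" "f ^ (l * t + 1) + r ^ t = 0"
  shows "\<exists>c. \<forall>a. a \<noteq> 0 \<longrightarrow> (\<exists>\<phi>. khom \<phi> \<and> \<phi> F = f \<and> \<phi> G = 0 \<and> \<phi> Q = r ^ p \<and> \<phi> Q1 = a - c)"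
proof -
  have ex: "\<exists>\<phi>. khom \<phi> \<and> \<phi> x1 = a \<and> \<phi> F = f \<and> \<phi> R = r \<and> \<phi> G = 0" if "a \<noteq> 0" for a
    using assms that by (intro khom_exists) auto
  \<comment> \<open>This map only serves to name the image of \<open>H\<close>. As \<open>H\<close>
    is a polynomial in \<open>F\<close> and \<open>G\<close>, every \<open>\<phi>\<close> below
    gives the same value, so \<open>c\<close> is independent of \<open>a\<close>.\<close>
  obtain \<chi> where \<chi>: "khom \<chi>" "\<chi> F = f" "\<chi> R = r" "\<chi> G = 0" using ex[of 1] by auto
  have p1: "p - 1 > 0" using p2 by simp
  define c where "c = f ^ (l * (p - 1)) * (0 ^ (p - 2) * \<chi> H ^ (p - 1) * r *
    (\<Sum>i<e. (r ^ p) ^ (e - Suc i) * (r ^ p) ^ i))"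
  show ?thesis
  proof (rule exI[of _ c], intro allI impI)
    fix a :: "'k rat3" assume "a \<noteq> 0"
    then obtain \<phi> where \<phi>: "khom \<phi>" "\<phi> x1 = a" "\<phi> F = f" "\<phi> R = r" "\<phi> G = 0"
      using ex by blast
    interpret \<phi>: ring_map \<phi> using \<phi>(1) by (simp add: khom_def)
    have HH: "\<phi> H = \<chi> H" by (rule khom_alg_eq[OF \<phi>(1) \<chi>(1) H]) (use \<phi> \<chi> in auto)
    have QQ: "\<phi> Q = r ^ p" using p1 by (simp add: Q_def D_def \<phi> power_0_left)
    have "\<phi> Q1 = a - c" by (simp add: Q1_def Y_def \<phi> HH QQ c_def)
    then show "\<exists>\<phi>. khom \<phi> \<and> \<phi> F = f \<and> \<phi> G = 0 \<and> \<phi> Q = r ^ p \<and> \<phi> Q1 = a - c"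
      using \<phi> QQ by blast
  qed
qed

text \<open>With the images of \<open>F\<close> and \<open>R\<close> fixed on the curve,
  \<open>Q1\<close> still takes all values but one, which separates its powers. A relation among the
  powers of \<open>r ^ p\<close> over k[f] remains; it is trivial because \<open>l * t + 1\<close>
  is prime to \<open>e\<close>, a divisor of \<open>t\<close>.\<close>

lemma B0_modG_independent:
  assumes "G dvd (\<Sum>i<e. Q ^ i * evalh (evalh const3 F) Q1 (E i))" and "j < e"
  shows "E j = 0"
proof -
  \<comment> \<open>The curve is parametrized by \<open>X2\<close>; the signs give
    \<open>f ^ (l * t + 1) = - (r ^ t)\<close> for all parities of \<open>l\<close> and
    \<open>t\<close>.\<close>
  define f where "f = - ((X2 :: 'k rat3) ^ t)"
  define r where "r = (-1) ^ l * (X2 :: 'k rat3) ^ (l * t + 1)"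
  have X2: "(X2 :: 'k rat3) \<noteq> 0" using inj_emb3[of "x2 :: 'k poly poly poly" 0] e3.zero
    by (simp add: X_eq x2_def)
  then have "f \<noteq> 0" by (simp add: f_def)
  have "f ^ (l * t + 1) = - ((-1) ^ (l * t) * X2 ^ (t * (l * t + 1)))"
    unfolding f_def by (subst power_minus) (simp add: power_mult power_add mult.commute)
  moreover have "r ^ t = (-1) ^ (l * t) * X2 ^ (t * (l * t + 1))"
    unfolding r_def power_mult_distrib power_mult[symmetric] by (simp only: mult.commute)
  ultimately have "f ^ (l * t + 1) + r ^ t = 0" by simp
  then obtain c where c: "\<And>a. a \<noteq> 0 \<Longrightarrow>
      \<exists>\<phi>. khom \<phi> \<and> \<phi> F = f \<and> \<phi> G = 0 \<and> \<phi> Q = r ^ p \<and> \<phi> Q1 = a - c"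
    using khom_modG[OF \<open>f \<noteq> 0\<close>] by blast
  interpret Ef: ring_map "evalh constK f" by (rule cK.evalh_hom)
  interpret EX: ring_map "evalh constK X2" by (rule cK.evalh_hom)
  have "(\<Sum>i<e. smult ((r ^ p) ^ i) (map_poly (evalh constK f) (E i))) = 0"
  proof (rule poly_eq_0_cofinite[of "{- c}"])
    fix z :: "'k rat3" assume "z \<notin> {- c}"
    then have "z + c \<noteq> 0" by (simp add: eq_neg_iff_add_eq_0)
    then obtain \<phi> where \<phi>: "khom \<phi>" "\<phi> F = f" "\<phi> G = 0" "\<phi> Q = r ^ p" "\<phi> Q1 = z"
      using c[of "z + c"] by auto
    interpret \<phi>: ring_map \<phi> using \<phi>(1) by (simp add: khom_def)
    have "\<phi> (\<Sum>i<e. Q ^ i * evalh (evalh const3 F) Q1 (E i)) = 0"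
      using \<phi>.dvd[OF assms(1)] \<phi>(3) by simp
    then show "poly (\<Sum>i<e. smult ((r ^ p) ^ i) (map_poly (evalh constK f) (E i))) z = 0"
      by (simp add: khom_evalh2[OF \<phi>(1)] \<phi> poly_sum evalh_def[of "evalh constK f"])
  qed simp
  from arg_cong[OF this, of "\<lambda>P. coeff P n" for n]
  have sum0: "(\<Sum>i<e. (r ^ p) ^ i * evalh constK f (coeff (E i) n)) = 0" for n
    by (simp add: coeff_sum)
  show "E j = 0"
  proof (rule poly_eqI)
    fix n
    have r: "evalh constK X2 (monom ((-1) ^ l) (l * t + 1)) = r"
      by (simp add: evalh_def map_poly_monom poly_monom r_def)
    have f: "evalh constK X2 (pcompose P (monom (-1) t)) = evalh constK f P" for P
    proof (induction P)
      case (pCons a P)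
      have "evalh constK X2 (monom (-1) t) = f"
        by (simp add: evalh_def map_poly_monom poly_monom f_def)
      then show ?case using pCons by (simp add: pcompose_pCons cK.evalh_const)
    qed simp
    have "evalh constK X2 (\<Sum>i<e. monom ((-1) ^ l) (l * t + 1) ^ (p * i) *
        pcompose (coeff (E i) n) (monom (-1) (p * e))) = 0"
      using sum0[of n] by (simp only: EX.sum EX.mult EX.power r f power_mult t[symmetric])
    then have s: "(\<Sum>i<e. monom ((-1) ^ l) (l * t + 1) ^ (p * i) *
        pcompose (coeff (E i) n) (monom (-1) (p * e))) = 0"
      by (rule evalh_X2_eq_0)
    have "coprime (l * t + 1) e"
    proof (rule coprimeI)
      fix u assume "u dvd l * t + 1" "u dvd e"
      moreover have "u dvd l * t" using \<open>u dvd e\<close> by (simp add: t)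
      ultimately show "is_unit u" using dvd_add_right_iff by blast
    qed
    then have "coeff (E j) n = 0"
      by (intro monom_pcompose_independent[OF p_pos _ _ _ _ s \<open>j < e\<close>]) (use e1 in auto)
    then show "coeff (E j) n = coeff 0 n" by simp
  qed
qed

text \<open>The normal form is available only after multiplication by some \<open>F ^ n\<close>.
  Once \<open>G\<close> is cancelled, this power is removed by the corresponding property of
  \<open>F\<close>.\<close>

lemma G_mult_in_B: "G * a \<in> B \<Longrightarrow> a \<in> B"
proof -
  assume "G * a \<in> B"
  then obtain n where "F ^ n * (G * a) \<in> B0" using B_in_B0_localized by blast
  then obtain E b where b: "b \<in> B0"
    and eq: "F ^ n * (G * a) = (\<Sum>i<e. Q ^ i * evalh (evalh const3 F) Q1 (E i)) + G * b"
    using B0_decompose by blast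
  have "(\<Sum>i<e. Q ^ i * evalh (evalh const3 F) Q1 (E i)) = G * (F ^ n * a - b)"
    using eq by (simp add: algebra_simps)
  then have "G dvd (\<Sum>i<e. Q ^ i * evalh (evalh const3 F) Q1 (E i))" by simp
  then have "E j = 0" if "j < e" for j using that by (rule B0_modG_independent)
  then have "G * (F ^ n * a) = G * b" using eq by (simp add: algebra_simps)
  then have "F ^ n * a \<in> B" using b G_neq_0 B0_subset_B by auto
  then show "a \<in> B" by (rule F_power_mult_in_B)
qed

lemma FG_power_mult_in_B: "(F * G) ^ n * a \<in> B \<Longrightarrow> a \<in> B"
  by (induction n) (auto simp: mult.assoc dest: F_mult_in_B G_mult_in_B)

end

section \<open>Translations over k[f,1/f,g,1/g]\<close>

lemma pcompose_monom: "pcompose (monom c n) P = smult c (P ^ n)"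
  by (induction n) (simp_all add: monom_Suc pcompose_pCons monom_0)

lemma pcompose_pow: "pcompose (u ^ n) P = pcompose u P ^ n"
  by (induction n) (simp_all add: pcompose_mult pcompose_1)

lemma coeff_pcompose_translate:
  fixes v :: "'a::field poly"
  assumes "degree v \<le> k"
  shows "coeff (pcompose v [:d, 1:]) k = coeff v k"
proof (cases "degree v = k")
  case True
  then show ?thesis using lead_coeff_comp[of "[:d, 1:]" v] by (simp add: degree_pcompose)
next
  case False
  then show ?thesis using assms by (simp add: coeff_eq_0 degree_pcompose)
qed

text \<open>Translation by \<open>d\<close> changes the coefficient just below the leading one by
  \<open>degree u\<close> times \<open>d\<close> times the leading coefficient, and invariance makes
  this zero.\<close>

lemma degree_translation_invariant:
  fixes u :: "'a::field poly"
  assumes "pcompose u [:d, 1:] = u" "d \<noteq> 0"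
  shows "CHAR('a) dvd degree u"
proof (cases "degree u")
  case (Suc n)
  define c where "c = lead_coeff u"
  define v where "v = u - monom c (Suc n)"
  have "u \<noteq> 0" using Suc by auto
  then have "c \<noteq> 0" by (simp add: c_def)
  have "\<forall>k\<ge>Suc n. coeff v k = 0"
    using Suc by (auto simp: v_def c_def coeff_eq_0)
  then have "degree v < Suc n" by (intro degree_lessI) auto
  then have v: "coeff (pcompose v [:d, 1:]) n = coeff v n" by (intro coeff_pcompose_translate) simp
  have "u = monom c (Suc n) + v" by (simp add: v_def)
  then have "u = smult c ([:d, 1:] ^ Suc n) + pcompose v [:d, 1:]"
    using assms(1) by (metis pcompose_add pcompose_monom)
  then have "coeff u n = c * coeff ([:d, 1:] ^ Suc n) n + coeff v n"
    using v by (metis coeff_add coeff_smult)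
  moreover have "coeff u n = coeff v n" by (simp add: v_def)
  moreover have "coeff ([:d, 1:] ^ Suc n) n = of_nat (Suc n) * d"
    by (subst coeff_linear_poly_power) (simp_all del: power_Suc of_nat_Suc)
  ultimately have "(of_nat (Suc n) :: 'a) = 0" using \<open>c \<noteq> 0\<close> \<open>d \<noteq> 0\<close> by simp
  then show ?thesis using Suc by (simp only: of_nat_eq_0_iff_char_dvd)
qed simp

context action
begin

abbreviation f where "f \<equiv> emb3 F"
abbreviation g where "g \<equiv> emb3 G"
abbreviation r where "r \<equiv> emb3 R"
abbreviation d where "d \<equiv> emb3 D"
abbreviation q where "q \<equiv> emb3 Q"
abbreviation q1 where "q1 \<equiv> emb3 Q1"

lemma fg_neq_0: "f \<noteq> 0" "g \<noteq> 0"
  using F_neq_0 G_neq_0 inj_emb3[of F 0] inj_emb3[of G 0] by auto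

definition C where "C = alg constK {f, inverse f, g, inverse g}"
text \<open>\<open>C\<close> is a subset of the field and not a type, so C[Y] is encoded as the
  polynomials over the field with coefficients in \<open>C\<close>; \<open>adj y\<close> is its
  image C[y].\<close>

definition CV where "CV = {u. \<forall>i. coeff u i \<in> C}"
definition adj where "adj y = alg constK {f, inverse f, g, inverse g, y}"

lemmas C_closed = alg.add[of _ constK "{f, inverse f, g, inverse g}", folded C_def]
  alg.mult[of _ constK "{f, inverse f, g, inverse g}", folded C_def]
  alg_diff[of _ constK "{f, inverse f, g, inverse g}", folded C_def]
  alg.uminus[of _ constK "{f, inverse f, g, inverse g}", folded C_def]
  cK.alg_power[of _ "{f, inverse f, g, inverse g}", folded C_def]
  cK.alg_sum[of _ _ "{f, inverse f, g, inverse g}", folded C_def]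

lemmas C_01 = cK.alg_0[of "{f, inverse f, g, inverse g}", folded C_def]
  cK.alg_1[of "{f, inverse f, g, inverse g}", folded C_def]

lemma C_gens: "f \<in> C" "inverse f \<in> C" "g \<in> C" "inverse g \<in> C"
  by (auto simp: C_def intro: alg.gen)

lemmas adj_closed = alg.add[of _ constK "{f, inverse f, g, inverse g, y}", folded adj_def]
  alg.mult[of _ constK "{f, inverse f, g, inverse g, y}", folded adj_def]
  alg_diff[of _ constK "{f, inverse f, g, inverse g, y}", folded adj_def]
  alg.uminus[of _ constK "{f, inverse f, g, inverse g, y}", folded adj_def]
  cK.alg_power[of _ "{f, inverse f, g, inverse g, y}", folded adj_def]
  cK.alg_sum[of _ _ "{f, inverse f, g, inverse g, y}", folded adj_def] for y

lemma adj_gens: "f \<in> adj y" "inverse f \<in> adj y" "g \<in> adj y" "inverse g \<in> adj y" "y \<in> adj y"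
  by (auto simp: adj_def intro: alg.gen)

lemma C_subset_adj: "C \<subseteq> adj y"
  unfolding C_def adj_def by (rule subsetI, erule alg_mono[rotated]) auto

lemma CV_closed:
  "u \<in> CV \<Longrightarrow> v \<in> CV \<Longrightarrow> u + v \<in> CV"
  "u \<in> CV \<Longrightarrow> v \<in> CV \<Longrightarrow> u - v \<in> CV"
  "u \<in> CV \<Longrightarrow> - u \<in> CV"
  "u \<in> CV \<Longrightarrow> v \<in> CV \<Longrightarrow> u * v \<in> CV"
  "c \<in> C \<Longrightarrow> u \<in> CV \<Longrightarrow> smult c u \<in> CV"
  "c \<in> C \<Longrightarrow> u \<in> CV \<Longrightarrow> pCons c u \<in> CV"
  by (auto simp: CV_def coeff_mult coeff_pCons intro: C_closed split: nat.splits)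

lemma CV_01: "0 \<in> CV" "1 \<in> CV"
  by (auto simp: CV_def coeff_1 C_01)

lemma CV_monom: "c \<in> C \<Longrightarrow> monom c n \<in> CV"
  by (auto simp: CV_def C_01)

lemma CV_power: "u \<in> CV \<Longrightarrow> u ^ n \<in> CV"
  by (induction n) (auto intro: CV_closed CV_01)

lemma CV_pcompose:
  assumes "u \<in> CV" "v \<in> CV" shows "pcompose u v \<in> CV"
  using assms(1)
proof (induction u)
  case (pCons a u)
  have a: "a \<in> C" using pCons.prems by (auto simp: CV_def dest: spec[of _ 0])
  have "u \<in> CV" unfolding CV_def
  proof clarify
    fix i show "coeff u i \<in> C"
      using pCons.prems by (auto simp: CV_def dest: spec[of _ "Suc i"])
  qed
  then have "pcompose u v \<in> CV" by (rule pCons.IH)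
  then show ?case using a assms(2) by (auto simp: pcompose_pCons intro: CV_closed CV_01)
qed (simp add: CV_01)

lemma poly_in_adj: "u \<in> CV \<Longrightarrow> poly u y \<in> adj y"
  unfolding poly_altdef using C_subset_adj[of y]
  by (intro adj_closed adj_gens) (auto simp: CV_def)

lemma adj_poly:
  assumes "a \<in> adj y" shows "\<exists>u\<in>CV. a = poly u y"
  using assms unfolding adj_def
proof induction
  case (const c)
  have "[:constK c:] \<in> CV" by (intro CV_closed CV_01) (simp add: C_def alg.const)
  then show ?case by (intro bexI[of _ "[:constK c:]"]) auto
next
  case (gen s)
  then consider "s \<in> C" | "s = y" using C_gens by blast
  then show ?case
  proof cases
    case 1
    then have "[:s:] \<in> CV" by (intro CV_closed CV_01)
    then show ?thesis by (intro bexI[of _ "[:s:]"]) auto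
  next
    case 2
    have "[:0, 1:] \<in> CV" by (intro CV_closed CV_01 C_01)
    then show ?thesis using 2 by (intro bexI[of _ "[:0, 1:]"]) auto
  qed
next
  case (add a b)
  then obtain u v where "u \<in> CV" "v \<in> CV" "a = poly u y" "b = poly v y" by blast
  then show ?case by (intro bexI[of _ "u + v"]) (auto intro: CV_closed)
next
  case (mult a b)
  then obtain u v where "u \<in> CV" "v \<in> CV" "a = poly u y" "b = poly v y" by blast
  then show ?case by (intro bexI[of _ "u * v"]) (auto intro: CV_closed)
next
  case (uminus a)
  then obtain u where "u \<in> CV" "a = poly u y" by blast
  then show ?case by (intro bexI[of _ "- u"]) (auto intro: CV_closed)
qed

lemma clear_fg:
  assumes "a \<in> alg constK {f, inverse f, g, inverse g, y}"
  shows "\<exists>n. (f * g) ^ n * a \<in> alg constK {f, g, y}"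
proof (rule cK.alg_clear_denominator[OF assms])
  show fg: "f * g \<in> alg constK {f, g, y}" by (intro alg.mult alg.gen) auto
  have "(f * g) ^ 1 * inverse f = g" "(f * g) ^ 1 * inverse g = f"
    using fg_neq_0 by simp_all
  moreover have "g \<in> alg constK {f, g, y}" "f \<in> alg constK {f, g, y}" by (auto intro: alg.gen)
  ultimately have "\<exists>n. (f * g) ^ n * inverse f \<in> alg constK {f, g, y}"
    "\<exists>n. (f * g) ^ n * inverse g \<in> alg constK {f, g, y}" by metis+
  moreover have "\<exists>n. (f * g) ^ n * s \<in> alg constK {f, g, y}" if "s \<in> {f, g, y}" for s
    using that by (intro exI[of _ 0]) (auto intro: alg.gen)
  ultimately show "\<exists>n. (f * g) ^ n * s \<in> alg constK {f, g, y}"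
    if "s \<in> {f, inverse f, g, inverse g, y}" for s
    using that by blast
qed

text \<open>One exponent serves all coefficients, so that a relation over \<open>C\<close> becomes a
  single polynomial expression over k[f,g], to which k-algebra maps can be applied.\<close>

lemma CV_clear_fg:
  assumes "u \<in> CV"
  shows "\<exists>n. \<forall>i. (f * g) ^ n * coeff u i \<in> alg constK {f, g}"
  using assms
proof (induction u)
  case 0 show ?case by (simp add: cK.alg_0)
next
  case (pCons a u)
  have "coeff u i \<in> C" for i using pCons.prems by (auto simp: CV_def dest: spec[of _ "Suc i"])
  then obtain j where j: "\<And>i. (f * g) ^ j * coeff u i \<in> alg constK {f, g}"
    using pCons.IH by (auto simp: CV_def)
  have "a \<in> C" using pCons.prems by (auto simp: CV_def dest: spec[of _ 0])
  then have "a \<in> alg constK {f, inverse f, g, inverse g, f}" unfolding C_def by (rule alg_mono[rotated]) auto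
  from clear_fg[OF this] obtain k where k: "(f * g) ^ k * a \<in> alg constK {f, g}"
    by (auto simp: insert_commute)
  have fg: "(f * g) ^ n \<in> alg constK {f, g}" for n
    by (intro cK.alg_power alg.mult alg.gen) auto
  have "(f * g) ^ (j + k) * coeff (pCons a u) i \<in> alg constK {f, g}" for i
  proof (cases i)
    case 0
    have "(f * g) ^ (j + k) * coeff (pCons a u) i = (f * g) ^ j * ((f * g) ^ k * a)"
      by (simp add: 0 power_add mult.assoc)
    then show ?thesis using alg.mult[OF fg k] by simp
  next
    case (Suc i')
    have "(f * g) ^ (j + k) * coeff (pCons a u) i = (f * g) ^ k * ((f * g) ^ j * coeff u i')"
      by (simp add: Suc power_add mult.assoc mult.left_commute)
    then show ?thesis using alg.mult[OF fg j] by simp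
  qed
  then show ?case by blast
qed

lemma t_pos: "t > 0"
  using mt by (cases t) auto

text \<open>The k-algebra maps fixing $f$ and $g$ and sending $r$ to an almost arbitrary $z$ turn almost every element of $k(x_1,x_2,x_3)$ into a root of $u$.\<close>

lemma r_transcendental:
  assumes "u \<in> CV" "poly u r = 0"
  shows "u = 0"
proof -
  obtain n where n: "\<And>i. (f * g) ^ n * coeff u i \<in> alg constK {f, g}"
    using CV_clear_fg[OF assms(1)] by blast
  have "\<exists>\<alpha>. \<forall>i. \<alpha> i \<in> alg const3 {F, G} \<and> emb3 (\<alpha> i) = (f * g) ^ n * coeff u i"
  proof (rule choice, rule allI)
    fix i
    have "(f * g) ^ n * coeff u i \<in> emb3 ` alg const3 {F, G}"
      using n by (simp add: emb3_image_alg)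
    then show "\<exists>x. x \<in> alg const3 {F, G} \<and> emb3 x = (f * g) ^ n * coeff u i" by auto
  qed
  then obtain \<alpha> where \<alpha>: "\<And>i. \<alpha> i \<in> alg const3 {F, G}" "\<And>i. emb3 (\<alpha> i) = (f * g) ^ n * coeff u i"
    by blast
  define a where "a = (\<Sum>i\<le>degree u. \<alpha> i * R ^ i)"
  have "emb3 a = (f * g) ^ n * poly u r"
    by (simp add: a_def \<alpha> poly_altdef sum_distrib_left mult.assoc)
  then have a0: "a = 0" using assms(2) inj_emb3[of a 0] by simp
  \<comment> \<open>For these \<open>z\<close> the image of \<open>x1\<close>, which must be
    \<open>(f ^ (l * t + 1) + z ^ t) / g\<close>, would be zero and \<open>khom_exists\<close> would
    not apply.\<close>
  define E where "E = {z. poly (monom 1 t + [:f ^ (l * t + 1):]) z = 0}"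
  have "monom 1 t + [:f ^ (l * t + 1):] \<noteq> 0"
  proof
    assume "monom 1 t + [:f ^ (l * t + 1):] = 0"
    from arg_cong[OF this, of "\<lambda>P. poly P 0"] show False
      using t_pos fg_neq_0 by (simp add: poly_monom power_0_left)
  qed
  then have "finite E" unfolding E_def by (rule poly_roots_finite)
  then show ?thesis
  proof (rule poly_eq_0_cofinite)
    fix z assume "z \<notin> E"
    then have "f ^ (l * t + 1) + z ^ t \<noteq> 0"
      by (simp add: E_def poly_monom add.commute)
    then have "(f ^ (l * t + 1) + z ^ t) / g \<noteq> 0" using fg_neq_0 by simp
    from khom_exists[OF fg_neq_0(1) this, of g z] fg_neq_0
    obtain \<phi> where \<phi>: "khom \<phi>" "\<phi> F = f" "\<phi> R = z" "\<phi> G = g" by auto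
    interpret \<phi>: ring_map \<phi> using \<phi>(1) by (simp add: khom_def)
    have "\<phi> (\<alpha> i) = emb3 (\<alpha> i)" for i
      using \<phi> by (intro khom_alg_eq[OF \<phi>(1) khom_emb3 \<alpha>(1)]) auto
    then have "\<phi> a = (f * g) ^ n * poly u z"
      by (simp add: a_def \<phi> \<alpha> poly_altdef sum_distrib_left mult.assoc)
    then show "poly u z = 0" using a0 fg_neq_0 by simp
  qed
qed

lemma r_power_transcendental:
  assumes "u \<in> CV" "poly u (r ^ p) = 0"
  shows "u = 0"
proof -
  have "pcompose u (monom 1 p) = 0"
    using assms by (intro r_transcendental CV_pcompose CV_monom C_01) (auto simp: poly_pcompose poly_monom)
  then show ?thesis
    by (rule pcompose_eq_0) (use p_pos in \<open>simp add: degree_monom_eq\<close>)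
qed

text \<open>Transcendence of \<open>y\<close> over \<open>C\<close> makes the polynomial in
  \<open>subst_over\<close> unique, so the definite description becomes ordinary evaluation.\<close>

lemma subst_over_poly:
  assumes "\<And>u. u \<in> CV \<Longrightarrow> poly u y = 0 \<Longrightarrow> u = 0" and "u \<in> CV"
  shows "subst_over C y z (poly u y) = poly u z"
proof -
  have "(THE v. (\<forall>i. coeff v i \<in> C) \<and> poly v y = poly u y) = u"
  proof (rule the_equality)
    show "(\<forall>i. coeff u i \<in> C) \<and> poly u y = poly u y" using assms(2) by (simp add: CV_def)
    fix v assume v: "(\<forall>i. coeff v i \<in> C) \<and> poly v y = poly u y"
    then have "v - u = 0" using assms(2) by (intro assms(1) CV_closed) (auto simp: CV_def)
    then show "v = u" by simp
  qed
  then show ?thesis by (simp add: subst_over_def)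
qed

text \<open>For $y = r$, $r^p$, $q$ the triple $(y_1,y_2,y_3)$ is $(x_1,x_2,x_3)$, $(x_1,x_2^p,x_3)$, $(q_1,q_2,q_3)$, respectively.\<close>

lemma adj_triple:
  assumes y1: "g * y1 = f ^ (l * t + 1) + y ^ n" and \<theta>: "\<theta> \<in> alg constK {f, y1}"
    and y2: "f ^ j * y2 = y - y1 * \<theta>" and y3: "y1 * y3 = f + y2 ^ n"
    and "j * n = l * t" "y1 \<noteq> 0"
  shows "y1 \<in> adj y" "y2 \<in> adj y" "y3 \<in> adj y"
proof -
  have "y1 = inverse g * (f ^ (l * t + 1) + y ^ n)" unfolding y1[symmetric] using fg_neq_0 by simp
  also have "\<dots> \<in> adj y" by (intro adj_closed adj_gens)
  finally show 1: "y1 \<in> adj y" .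
  have \<theta>: "\<theta> \<in> adj y" unfolding adj_def using \<theta>
    by (rule alg_least) (use 1 adj_gens in \<open>auto simp: adj_def\<close>)
  have "y2 = inverse f ^ j * (y - y1 * \<theta>)"
    using fg_neq_0 by (simp flip: y2 add: power_inverse)
  also have "\<dots> \<in> adj y" by (intro adj_closed adj_gens 1 \<theta>)
  finally show "y2 \<in> adj y" .
  \<comment> \<open>Division by \<open>y1\<close> could leave \<open>adj y\<close>. Instead a factor
    \<open>y1\<close> is split off from \<open>f ^ (l * t) * (f + y2 ^ n)\<close> and cancelled, so
    that \<open>y3\<close> has only a power of \<open>f\<close> as denominator.\<close>
  define Z where "Z = (\<Sum>i<n. y ^ (n - Suc i) * (y - y1 * \<theta>) ^ i)"
  have "(y - y1 * \<theta>) ^ n - y ^ n = (y - y1 * \<theta> - y) * Z"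
    unfolding Z_def by (rule power_diff_sumr2)
  then have Z: "(y - y1 * \<theta>) ^ n = y ^ n - y1 * \<theta> * Z" by (simp add: algebra_simps)
  have "y1 * (f ^ (l * t) * y3) = f ^ (l * t) * (f + y2 ^ n)" by (simp flip: y3 add: ac_simps)
  also have "\<dots> = f ^ (l * t + 1) + (f ^ j * y2) ^ n"
    by (simp add: power_mult_distrib algebra_simps flip: power_mult \<open>j * n = l * t\<close>)
  also have "\<dots> = (f ^ (l * t + 1) + y ^ n) - y1 * \<theta> * Z" unfolding y2 Z by simp
  also have "\<dots> = y1 * (g - \<theta> * Z)" unfolding y1[symmetric] by (simp add: algebra_simps)
  finally have "f ^ (l * t) * y3 = g - \<theta> * Z" using \<open>y1 \<noteq> 0\<close> by simp
  then have "y3 = inverse f ^ (l * t) * (g - \<theta> * Z)"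
    using fg_neq_0 by (simp add: power_inverse field_simps)
  also have "\<dots> \<in> adj y" unfolding Z_def by (intro adj_closed adj_gens 1 \<theta>)
  finally show "y3 \<in> adj y" .
qed

lemma X_neq_0: "emb3 x1 \<noteq> (0 :: 'k rat3)"
  using inj_emb3[of "x1 :: 'k poly poly poly" 0] by simp

lemma emb3_X_relations:
  "g * emb3 x1 = f ^ (l * t + 1) + r ^ t"
  "emb3 x1 * emb3 x3 = f + emb3 x2 ^ t"
  using arg_cong[OF G, of emb3] arg_cong[OF F, of emb3] by (simp_all add: mult.commute)

lemma X_in_adj_r: "emb3 x1 \<in> adj r" "emb3 x2 \<in> adj r" "emb3 x3 \<in> adj r"
proof -
  have "Suc (m - 1) = m" using m by simp
  then have "emb3 x1 * emb3 x1 ^ (m - 1) = emb3 (x1 :: 'k poly poly poly) ^ m" by (metis power_Suc)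
  then have "f ^ l * emb3 x2 = r - emb3 x1 * emb3 x1 ^ (m - 1)" by (simp add: R)
  note adj_triple[OF emb3_X_relations(1) _ this emb3_X_relations(2) refl X_neq_0]
  then show "emb3 x1 \<in> adj r" "emb3 x2 \<in> adj r" "emb3 x3 \<in> adj r"
    by (auto intro: cK.alg_power alg.gen)
qed

lemma R_p_X: "f ^ (l * p) * emb3 x2 ^ p = r ^ p - emb3 x1 * emb3 x1 ^ (m * p - 1)"
proof -
  have "Suc (m * p - 1) = m * p" using m p_pos by simp
  then have "emb3 x1 * emb3 x1 ^ (m * p - 1) = emb3 (x1 :: 'k poly poly poly) ^ (m * p)"
    by (metis power_Suc)
  then show ?thesis using arg_cong[OF R_p, of emb3] by simp
qed

lemma X_in_adj_r_power: "emb3 x1 \<in> adj (r ^ p)" "emb3 x2 ^ p \<in> adj (r ^ p)" "emb3 x3 \<in> adj (r ^ p)"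
proof -
  have 1: "g * emb3 x1 = f ^ (l * t + 1) + (r ^ p) ^ e"
    unfolding emb3_X_relations by (simp add: t power_mult)
  have 2: "emb3 x1 * emb3 x3 = f + (emb3 x2 ^ p) ^ e"
    unfolding emb3_X_relations by (simp add: t power_mult)
  have "l * p * e = l * t" by (simp add: t)
  note adj_triple[OF 1 _ R_p_X 2 this X_neq_0]
  then show "emb3 x1 \<in> adj (r ^ p)" "emb3 x2 ^ p \<in> adj (r ^ p)" "emb3 x3 \<in> adj (r ^ p)"
    by (auto intro: cK.alg_power alg.gen)
qed

lemma emb3_in_adj_r: "emb3 a \<in> adj r"
proof -
  have "emb3 a \<in> alg constK {emb3 x1, emb3 x2, emb3 x3}"
    using emb3_in_alg[OF alg_x123[of a]] by simp
  then show ?thesis unfolding adj_def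
    by (rule alg_least) (use X_in_adj_r in \<open>auto simp: adj_def\<close>)
qed

lemma d_in_C: "d \<in> C"
proof -
  have "emb3 H \<in> alg constK {f, g}" using emb3_in_alg[OF H] by simp
  then have "emb3 H \<in> C" unfolding C_def by (rule alg_mono[rotated]) auto
  then show ?thesis unfolding D_def by (auto intro: C_closed C_gens)
qed

section \<open>Polynomials over C invariant under translation by d\<close>

definition artin_schreier where "artin_schreier = monom 1 p - monom (d ^ (p - 1)) 1"

lemma artin_schreier_in_CV: "artin_schreier \<in> CV"
  unfolding artin_schreier_def by (intro CV_closed CV_monom C_closed d_in_C C_01)

lemma poly_artin_schreier: "poly artin_schreier x = x ^ p - d ^ (p - 1) * x"
  by (simp add: artin_schreier_def poly_monom)

lemma poly_artin_schreier_r: "poly artin_schreier r = q"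
  by (simp add: poly_artin_schreier Q_def)

lemma degree_artin_schreier: "degree artin_schreier = p" and lead_coeff_artin_schreier: "lead_coeff artin_schreier = 1"
proof -
  have lt: "degree (monom (d ^ (p - 1)) 1) < degree (monom (1 :: 'k rat3) p)"
    using p2 degree_monom_le[of "d ^ (p - 1)" 1] by (simp add: degree_monom_eq)
  show deg: "degree artin_schreier = p"
    using degree_add_eq_left[of "- monom (d ^ (p - 1)) 1" "monom (1 :: 'k rat3) p"] lt
    by (simp add: artin_schreier_def degree_monom_eq)
  show "lead_coeff artin_schreier = 1" unfolding deg using p2 by (simp add: artin_schreier_def)
qed

text \<open>The polynomial is additive in characteristic \<open>p\<close>, and \<open>d\<close> is
  one of its roots.\<close>

lemma artin_schreier_translate: "pcompose artin_schreier [:d, 1:] = artin_schreier"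
proof -
  have "([:d:] + [:0, 1:]) ^ p = [:d:] ^ p + [:0, 1:] ^ p"
    by (rule freshmans_dream) (simp_all add: CHAR_fract CHAR_p prime_p)
  then have 1: "[:d, 1:] ^ p = [:d ^ p:] + monom 1 p"
    by (simp add: poly_const_pow monom_altdef)
  have "Suc (p - 1) = p" using p_pos by simp
  then have "d ^ (p - 1) * d = d ^ p" by (metis power_Suc2)
  then have 2: "smult (d ^ (p - 1)) [:d, 1:] = [:d ^ p:] + monom (d ^ (p - 1)) 1"
    by (simp add: monom_Suc monom_0)
  show ?thesis unfolding artin_schreier_def pcompose_diff pcompose_monom 
    using 1 2 by simp
qed

text \<open>An invariant has degree divisible by \<open>p\<close>, so a multiple of a power of
  \<open>artin_schreier\<close> removes its leading term and leaves an invariant of lower degree. As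
  \<open>artin_schreier\<close> is monic, the multiplier is the leading coefficient and stays in
  \<open>C\<close>.\<close>

lemma translation_invariants:
  assumes "u \<in> CV" "pcompose u [:d, 1:] = u" "d \<noteq> 0"
  shows "\<exists>v\<in>CV. u = pcompose v artin_schreier"
  using assms(1,2)
proof (induction "degree u" arbitrary: u rule: less_induct)
  case less
  show ?case
  proof (cases "degree u = 0")
    case True
    then obtain c where "u = [:c:]" using degree_eq_zeroE by blast
    then show ?thesis using less.prems(1) by (intro bexI[of _ u]) auto
  next
    case False
    have "p dvd degree u"
      using degree_translation_invariant[OF less.prems(2) assms(3)] by (simp add: CHAR_fract CHAR_p)
    then obtain k where k: "degree u = p * k" ..
    define c where "c = lead_coeff u"
    define w where "w = u - smult c (artin_schreier ^ k)"
    have "c \<in> C" using less.prems(1) by (simp add: c_def CV_def)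
    have "artin_schreier \<noteq> 0" using lead_coeff_artin_schreier by auto
    then have ASk: "degree (artin_schreier ^ k) = degree u"
      by (simp add: degree_power_eq k degree_artin_schreier)
    have "lead_coeff (artin_schreier ^ k) = 1" by (simp only: lead_coeff_power lead_coeff_artin_schreier power_one)
    note ASk = ASk this
    have "coeff w i = 0" if "i \<ge> degree u" for i
    proof (cases "i = degree u")
      case True
      then show ?thesis using ASk by (simp add: w_def c_def)
    next
      case False
      then show ?thesis using that ASk by (simp add: w_def coeff_eq_0)
    qed
    then have "degree w < degree u" using False by (intro degree_lessI) auto
    moreover have "w \<in> CV"
      unfolding w_def by (intro CV_closed CV_power artin_schreier_in_CV less.prems \<open>c \<in> C\<close>)
    moreover have "pcompose w [:d, 1:] = w"
      unfolding w_def pcompose_diff pcompose_smult pcompose_pow artin_schreier_translate less.prems(2) ..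
    ultimately obtain v where v: "v \<in> CV" "w = pcompose v artin_schreier" using less.hyps by blast
    have "u = pcompose (v + monom c k) artin_schreier"
      by (simp add: pcompose_add pcompose_monom flip: v(2)) (simp add: w_def)
    then show ?thesis using v(1) \<open>c \<in> C\<close> by (intro bexI[of _ "v + monom c k"]) (auto intro: CV_closed CV_monom)
  qed
qed

definition Inv where "Inv = {b \<in> polyring. subst_over C r (r + d) b = b}"

text \<open>Transcendence of \<open>r\<close> turns invariance of u(r) into invariance of the
  polynomial u under translation by \<open>d\<close>. Then u is a polynomial in
  \<open>artin_schreier\<close>, whose value at \<open>r\<close> is \<open>q\<close>.\<close>

lemma Inv_iff:
  assumes "d \<noteq> 0"
  shows "b \<in> Inv \<longleftrightarrow> b \<in> polyring \<and> b \<in> adj q"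
proof -
  have "subst_over C r (r + d) b = b \<longleftrightarrow> b \<in> adj q" if "b \<in> polyring"
  proof -
    have "b \<in> adj r" using that by (auto simp: polyring_def emb3_in_adj_r)
    then obtain u where u: "u \<in> CV" "b = poly u r" using adj_poly by blast
    have s: "subst_over C r (r + d) (poly v r) = poly (pcompose v [:d, 1:]) r" if "v \<in> CV" for v
    proof -
      have "subst_over C r (r + d) (poly v r) = poly v (r + d)"
        by (rule subst_over_poly[OF _ that]) (rule r_transcendental)
      then show ?thesis by (simp add: poly_pcompose add.commute)
    qed
    show ?thesis
    proof
      assume "subst_over C r (r + d) b = b"
      then have "poly (pcompose u [:d, 1:] - u) r = 0" using s[OF u(1)] u(2) by simp
      then have "pcompose u [:d, 1:] - u = 0"
        using u(1) d_in_C by (intro r_transcendental CV_closed CV_pcompose CV_01 C_01)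
      then obtain v where v: "v \<in> CV" "u = pcompose v artin_schreier"
        using translation_invariants[OF u(1)] assms by auto
      then have "b = poly v q" by (simp add: u poly_pcompose poly_artin_schreier_r)
      then show "b \<in> adj q" using poly_in_adj[OF v(1)] by simp
    next
      assume "b \<in> adj q"
      then obtain v where v: "v \<in> CV" "b = poly v q" using adj_poly by blast
      then have b: "b = poly (pcompose v artin_schreier) r" by (simp add: poly_pcompose poly_artin_schreier_r)
      have "pcompose (pcompose v artin_schreier) [:d, 1:] = pcompose v artin_schreier"
        by (simp add: artin_schreier_translate flip: pcompose_assoc)
      then show "subst_over C r (r + d) b = b"
        using s[OF CV_pcompose[OF v(1) artin_schreier_in_CV]] by (simp flip: b)
    qed
  qed
  then show ?thesis by (auto simp: Inv_def)
qed

section \<open>The homomorphism psi from C[r^p] to C[r]\<close>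

definition \<psi> where "\<psi> = subst_over C (r ^ p) q"

lemma psi_poly: "u \<in> CV \<Longrightarrow> \<psi> (poly u (r ^ p)) = poly u q"
  unfolding \<psi>_def by (rule subst_over_poly) (rule r_power_transcendental)

lemma psi_hom:
  assumes "a \<in> adj (r ^ p)" "b \<in> adj (r ^ p)"
  shows "\<psi> (a + b) = \<psi> a + \<psi> b" "\<psi> (a * b) = \<psi> a * \<psi> b"
proof -
  obtain u v where uv: "u \<in> CV" "v \<in> CV" "a = poly u (r ^ p)" "b = poly v (r ^ p)"
    using assms adj_poly by blast
  then show "\<psi> (a + b) = \<psi> a + \<psi> b" "\<psi> (a * b) = \<psi> a * \<psi> b"
    using psi_poly[of "u + v"] psi_poly[of "u * v"] by (simp_all add: CV_closed psi_poly)
qed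

lemma psi_C: "c \<in> C \<Longrightarrow> \<psi> c = c"
  using psi_poly[of "[:c:]"] by (auto intro: CV_closed CV_01)

lemma psi_uminus: "a \<in> adj (r ^ p) \<Longrightarrow> \<psi> (- a) = - \<psi> a"
  using psi_hom(1)[of a "- a"] by (simp add: adj_closed psi_C C_01 eq_neg_iff_add_eq_0 add.commute)

lemma psi_r_power: "\<psi> (r ^ p) = q"
  using psi_poly[of "[:0, 1:]"] by (auto intro: CV_closed CV_01 C_01)

lemma psi_power: "a \<in> adj (r ^ p) \<Longrightarrow> \<psi> (a ^ n) = \<psi> a ^ n"
  by (induction n) (auto simp: psi_C C_01 psi_hom adj_closed)

text \<open>\<open>\<psi>\<close> is known to be a homomorphism only on \<open>adj (r ^ p)\<close>,
  so \<open>image_alg\<close> does not apply and membership in that subring has to be carried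
  along.\<close>

lemma psi_image_alg:
  assumes "S \<subseteq> adj (r ^ p)"
  shows "\<psi> ` alg constK S = alg constK (\<psi> ` S)"
proof -
  have adj: "a \<in> adj (r ^ p)" if "a \<in> alg constK S" for a
    unfolding adj_def using that by (rule alg_least) (use assms in \<open>auto simp: adj_def\<close>)
  have cc: "\<psi> (constK c) = constK c" for c by (intro psi_C) (simp add: C_def alg.const)
  show ?thesis
  proof
    show "\<psi> ` alg constK S \<subseteq> alg constK (\<psi> ` S)"
    proof clarify
      fix a assume "a \<in> alg constK S"
      then show "\<psi> a \<in> alg constK (\<psi> ` S)"
        by induction (auto simp: cc psi_hom psi_uminus adj intro: alg.intros)
    qed
    show "alg constK (\<psi> ` S) \<subseteq> \<psi> ` alg constK S"
    proof
      fix a assume "a \<in> alg constK (\<psi> ` S)"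
      then show "a \<in> \<psi> ` alg constK S"
      proof induction
        case (const c)
        then show ?case using cc by (intro image_eqI[of _ _ "constK c"]) (auto intro: alg.const)
      next
        case (gen s) then show ?case by (auto intro: alg.gen)
      next
        case (add a b)
        then obtain a' b' where "a = \<psi> a'" "b = \<psi> b'" "a' \<in> alg constK S" "b' \<in> alg constK S" by blast
        then show ?case
          by (intro image_eqI[of _ _ "a' + b'"]) (auto intro: alg.add simp: psi_hom adj)
      next
        case (mult a b)
        then obtain a' b' where "a = \<psi> a'" "b = \<psi> b'" "a' \<in> alg constK S" "b' \<in> alg constK S" by blast
        then show ?case
          by (intro image_eqI[of _ _ "a' * b'"]) (auto intro: alg.mult simp: psi_hom adj)
      next
        case (uminus a)
        then obtain a' where "a = \<psi> a'" "a' \<in> alg constK S" by blast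
        then show ?case
          by (intro image_eqI[of _ _ "- a'"]) (auto intro: alg.uminus simp: psi_uminus adj)
      qed
    qed
  qed
qed

lemma q1_relation: "g * q1 = f ^ (l * t + 1) + q ^ e"
  using arg_cong[OF Q1, of emb3] by simp

text \<open>\<open>\<psi>\<close> fixes \<open>f\<close> and \<open>g\<close> and sends
  \<open>r ^ p\<close> to \<open>q\<close>. It therefore carries the equation of \<open>x1\<close>
  over \<open>r ^ p\<close>, linear in \<open>x1\<close>, to that of \<open>q1\<close> over
  \<open>q\<close>.\<close>

lemma psi_x1: "\<psi> (emb3 x1) = q1"
proof -
  have "\<psi> (g * emb3 x1) = \<psi> (f ^ (l * t + 1) + (r ^ p) ^ e)"
    unfolding emb3_X_relations by (simp add: t power_mult)
  then have "g * \<psi> (emb3 x1) = f ^ (l * t + 1) + q ^ e"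
    by (simp only: psi_hom psi_power X_in_adj_r_power adj_gens adj_closed psi_r_power psi_C C_gens C_closed)
  then show ?thesis using q1_relation fg_neq_0 by (metis mult_cancel_left)
qed

lemma psi_x2_power: "f ^ (l * p) * \<psi> (emb3 x2 ^ p) = q - q1 ^ (m * p)"
proof -
  have "f ^ (l * p) * emb3 x2 ^ p + emb3 x1 ^ (m * p) = r ^ p"
    using arg_cong[OF R_p, of emb3] by simp
  then have "\<psi> (f ^ (l * p) * emb3 x2 ^ p + emb3 x1 ^ (m * p)) = q" by (simp only: psi_r_power)
  then have "f ^ (l * p) * \<psi> (emb3 x2 ^ p) + q1 ^ (m * p) = q"
    using X_in_adj_r_power
    by (simp only: psi_hom psi_power[of "emb3 x1"] psi_x1 adj_gens adj_closed psi_C C_gens C_closed)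
  then show ?thesis by (simp add: algebra_simps)
qed

lemma psi_x3: "q1 * \<psi> (emb3 x3) = f + \<psi> (emb3 x2 ^ p) ^ e"
proof -
  have "emb3 x1 * emb3 x3 = f + (emb3 x2 ^ p) ^ e"
    unfolding emb3_X_relations by (simp add: t power_mult)
  then have "\<psi> (emb3 x1 * emb3 x3) = \<psi> (f + (emb3 x2 ^ p) ^ e)" by simp
  then show ?thesis
    using X_in_adj_r_power
    by (simp only: psi_hom psi_power[of "emb3 x2 ^ p"] psi_x1 adj_gens adj_closed psi_C C_gens)
qed

lemma Q1_neq_0: "Q1 \<noteq> 0"
  using modF_simps(5)[of 1 0] ring_map.zero[OF ring_map_modF] by auto

lemma q1_neq_0: "q1 \<noteq> 0"
  using Q1_neq_0 inj_emb3[of Q1 0] by simp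

lemma psi_image:
  "\<psi> ` alg constK {emb3 x1, emb3 x2 ^ p, emb3 x3}
    = alg constK {q1, \<psi> (emb3 x2 ^ p), \<psi> (emb3 x3)}"
  using psi_image_alg[of "{emb3 x1, emb3 x2 ^ p, emb3 x3}"] X_in_adj_r_power by (simp add: psi_x1)

text \<open>Modulo \<open>F ^ l\<close>, \<open>G\<close> is a power of \<open>x1\<close>, and
  powers of \<open>x1\<close> cancel.\<close>

lemma cancel_G_power: "F ^ l dvd G ^ n * y \<Longrightarrow> F ^ l dvd y"
proof (induction n)
  case (Suc n)
  have "l \<le> l * p" using p_pos by simp
  then have "F ^ l dvd G - x1 ^ (m * t - 1)" using G_cong le_imp_power_dvd dvd_trans by blast
  then have "F ^ l dvd (G - x1 ^ (m * t - 1)) * (G ^ n * y)" by (rule dvd_mult2)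
  with Suc.prems have "F ^ l dvd G ^ Suc n * y - (G - x1 ^ (m * t - 1)) * (G ^ n * y)" by (rule dvd_diff)
  also have "\<dots> = x1 ^ (m * t - 1) * (G ^ n * y)" by (simp add: algebra_simps)
  finally have "F ^ l dvd G ^ n * y" by (rule cancel_x1_power)
  then show ?case by (rule Suc.IH)
qed simp

end

context action_inv
begin

lemma emb3_Q_in_adj: "q1 \<in> adj q" "emb3 Q2 \<in> adj q" "emb3 Q3 \<in> adj q"
proof -
  have 1: "f ^ (l * p) * emb3 Q2 = q - q1 * emb3 \<theta>" using arg_cong[OF Q2, of emb3] by simp
  have 2: "q1 * emb3 Q3 = f + emb3 Q2 ^ e" using arg_cong[OF Q1_Q3, of emb3] by simp
  have "emb3 \<theta> \<in> alg constK {f, q1}" using emb3_in_alg[OF theta_in] by simp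
  note adj_triple[OF q1_relation this 1 2 _ q1_neq_0]
  then show "q1 \<in> adj q" "emb3 Q2 \<in> adj q" "emb3 Q3 \<in> adj q" by (simp_all add: t)
qed

lemma Inv_eq:
  assumes "H \<noteq> 0"
  shows "Inv = alg constK {q1, emb3 Q2, emb3 Q3}"
proof -
  have "D \<noteq> 0" using assms F_neq_0 G_neq_0 by (simp add: D_def)
  then have d: "d \<noteq> 0" using inj_emb3[of D 0] by simp
  have B: "emb3 ` B = alg constK {q1, emb3 Q2, emb3 Q3}" by (simp add: B_def emb3_image_alg)
  have "emb3 ` B \<subseteq> Inv"
  proof
    fix b assume b: "b \<in> emb3 ` B"
    then have "b \<in> alg constK {q1, emb3 Q2, emb3 Q3}" unfolding B .
    then have "b \<in> adj q" unfolding adj_def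
      by (rule alg_least) (use emb3_Q_in_adj in \<open>auto simp: adj_def\<close>)
    then show "b \<in> Inv" using b by (auto simp: Inv_iff[OF d] polyring_def)
  qed
  moreover have "Inv \<subseteq> emb3 ` B"
  proof
    fix b assume "b \<in> Inv"
    then obtain a where b: "b = emb3 a" and "emb3 a \<in> adj q"
      by (auto simp: Inv_iff[OF d] polyring_def)
    then obtain n where "(f * g) ^ n * emb3 a \<in> alg constK {f, g, q}"
      using clear_fg unfolding adj_def by blast
    then have "emb3 ((F * G) ^ n * a) \<in> alg constK (emb3 ` {F, G, Q})" by simp
    then have "(F * G) ^ n * a \<in> alg const3 {F, G, Q}" by (simp only: emb3_in_alg_iff)
    then have "(F * G) ^ n * a \<in> B" unfolding B_def
      by (rule alg_least) (use F_in_B G_in_B Q_in_B in \<open>auto simp: B_def\<close>)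
    then show "b \<in> emb3 ` B" using FG_power_mult_in_B b by blast
  qed
  ultimately show ?thesis using B by blast
qed

end

section \<open>Generators of the ring of invariants and the criterion for psi\<close>

context action
begin

lemma action_inv_exists: "\<exists>w. action_inv p l m t e F R G H w"
proof -
  have "(G * H) ^ (p - 1) \<in> alg const3 {F, G}"
    by (rule c3.alg_power, rule alg.mult, rule alg.gen, simp, rule H)
  from F_G_cong_Q1[OF this] obtain w where "w \<in> alg const3 {F, Q1}" "F ^ l dvd (G * H) ^ (p - 1) - w"
    by blast
  then have "action_inv p l m t e F R G H w" by unfold_locales
  then show ?thesis ..
qed

lemma Inv_generators:
  assumes "H \<noteq> 0"
  shows "\<exists>q2 q3. q2 \<in> Inv \<and> q3 \<in> Inv \<and> q1 * q3 - q2 ^ e = f \<and> Inv = alg constK {q1, q2, q3}"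
proof -
  obtain w where "action_inv p l m t e F R G H w" using action_inv_exists by blast
  then interpret action_inv p l m t e F R G H w .
  have "emb3 Q2 \<in> Inv" "emb3 Q3 \<in> Inv" unfolding Inv_eq[OF assms] by (auto intro: alg.gen)
  moreover have "q1 * emb3 Q3 - emb3 Q2 ^ e = f" using arg_cong[OF Q1_Q3, of emb3] by simp
  ultimately show ?thesis using Inv_eq[OF assms] by blast
qed

text \<open>If the image of \<open>x2 ^ p\<close> is a polynomial, comparison with \<open>Q2\<close>
  shows that \<open>F ^ (l * p)\<close> divides \<open>F ^ (l * (p - 1)) * (w * Q1 ^ m)\<close>, the
  difference between \<open>Q1 ^ (m * p)\<close> and \<open>Q1 * \<theta>\<close>. Cancelling
  \<open>Q1\<close> gives divisibility of \<open>w\<close>, hence of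
  \<open>(G * H) ^ (p - 1)\<close>, and cancelling \<open>G\<close> gives that of
  \<open>H ^ (p - 1)\<close>.\<close>

lemma psi_image_eq_Inv_imp:
  assumes "H \<noteq> 0" and eq: "\<psi> ` alg constK {emb3 x1, emb3 x2 ^ p, emb3 x3} = Inv"
  shows "\<exists>a\<in>alg const3 {F, G}. H ^ (p - 1) = F ^ l * a"
proof -
  obtain w where "action_inv p l m t e F R G H w" using action_inv_exists by blast
  then interpret action_inv p l m t e F R G H w .
  have "\<psi> (emb3 x2 ^ p) \<in> Inv" unfolding eq[symmetric] by (intro imageI alg.gen) simp
  then obtain a where a: "\<psi> (emb3 x2 ^ p) = emb3 a" by (auto simp: Inv_def polyring_def)
  have "emb3 (F ^ (l * p) * a) = emb3 (Q - Q1 ^ (m * p))" using psi_x2_power by (simp add: a)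
  then have "F ^ (l * p) * a = Q - Q1 ^ (m * p)" by (simp only: inj_emb3)
  then have "F ^ (l * p) * (Q2 - a) = (Q - Q1 * \<theta>) - (Q - Q1 ^ (m * p))"
    by (simp only: right_diff_distrib Q2)
  also have "\<dots> = F ^ (l * (p - 1)) * (w * Q1 ^ m)" unfolding Q1_theta by simp
  finally have "F ^ (l * (p - 1)) * (w * Q1 ^ m) = F ^ (l * p) * (Q2 - a)" ..
  also have "l * p = l * (p - 1) + l" using p_pos by (simp add: diff_mult_distrib2)
  finally have "F ^ (l * (p - 1)) * (w * Q1 ^ m) = F ^ (l * (p - 1)) * (F ^ l * (Q2 - a))"
    by (simp only: power_add mult.assoc)
  then have "w * Q1 ^ m = F ^ l * (Q2 - a)" using F_neq_0 by simp
  then have "F ^ l dvd w * Q1 ^ m" by simp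
  moreover have "F ^ l dvd w * Q1 ^ n \<Longrightarrow> F ^ l dvd w" for n
  proof (induction n)
    case (Suc n)
    have "F ^ l dvd Q1 * (w * Q1 ^ n)" using Suc.prems by (simp add: ac_simps)
    then show ?case by (intro Suc.IH) (rule cancel_Q1)
  qed simp
  ultimately have "F ^ l dvd w" by blast
  with w have "F ^ l dvd (G * H) ^ (p - 1)" using dvd_add[of "F ^ l" "(G * H) ^ (p - 1) - w" w] by simp
  then have "F ^ l dvd G ^ (p - 1) * H ^ (p - 1)" by (simp only: power_mult_distrib)
  then have "F ^ l dvd H ^ (p - 1)" by (rule cancel_G_power)
  \<comment> \<open>The quotient is so far only a polynomial in the three variables; it is brought
    into k[F,G] by \<open>alg_F_dvd\<close>, with \<open>m * t - 1 \<ge> 1\<close> as the exponent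
    of \<open>G\<close> on \<open>F = 0\<close>.\<close>
  then show ?thesis
    using mt by (intro alg_F_dvd[of G "m * t - 1"]) (auto simp: modF_simps intro: c3.alg_power H)
qed

text \<open>Under the divisibility hypothesis \<open>w = 0\<close> is admissible, which makes
  \<open>Q1 * \<theta>\<close> equal to \<open>Q1 ^ (m * p)\<close>. Then \<open>Q2\<close> and
  \<open>Q3\<close> satisfy the equations that determine the images of \<open>x2 ^ p\<close> and
  \<open>x3\<close>.\<close>

lemma psi_image_eq_Inv_if:
  assumes "H \<noteq> 0" and "F ^ l dvd H ^ (p - 1)"
  shows "\<psi> ` alg constK {emb3 x1, emb3 x2 ^ p, emb3 x3} = Inv"
proof -
  have "F ^ l dvd (G * H) ^ (p - 1) - 0" using assms(2) by (simp add: power_mult_distrib)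
  with c3.alg_0[of "{F, Q1}"] interpret action_inv p l m t e F R G H 0
    by unfold_locales
  have "f ^ (l * p) * emb3 Q2 = q - q1 ^ (m * p)"
    using arg_cong[OF Q2, of emb3] by (simp add: Q1_theta)
  then have 2: "\<psi> (emb3 x2 ^ p) = emb3 Q2"
    using psi_x2_power fg_neq_0 by (metis mult_cancel_left power_not_zero)
  have "q1 * emb3 Q3 = f + emb3 Q2 ^ e" using arg_cong[OF Q1_Q3, of emb3] by simp
  then have "\<psi> (emb3 x3) = emb3 Q3" using psi_x3 q1_neq_0 2 by (metis mult_cancel_left)
  then show ?thesis unfolding psi_image Inv_eq[OF assms(1)] by (simp add: 2)
qed

end

theorem theorem5p3:
  fixes p l m t :: nat and h :: "'k::field rat3"
  assumes char: "CHAR('k) = p" and ppos: "p > 0"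
    and l: "l \<ge> 1" and m: "m \<ge> 1" and t: "t \<ge> 2" and mt: "m * t \<ge> 3"
    and pt: "p dvd t"
  defines "f \<equiv> X1 * X3 - X2 ^ t"
  defines "r \<equiv> f ^ l * X2 + X1 ^ m"
  defines "g \<equiv> inverse X1 * (f ^ (l * t + 1) + r ^ t)"
  defines "C \<equiv> kalg {f, inverse f, g, inverse g}"
  defines "q \<equiv> r ^ p - (f ^ l * g * h) ^ (p - 1) * r"
  defines "q1 \<equiv> inverse g * (f ^ (l * t + 1) + q ^ (t div p))"
  defines "Inv \<equiv> {b \<in> polyring. subst_over C r (r + f ^ l * g * h) b = b}"
  defines "\<psi> \<equiv> subst_over C (r ^ p) q"
  assumes h: "h \<in> kalg {f, g}" "h \<noteq> 0"
  shows "(\<exists>q2 q3. q2 \<in> Inv \<and> q3 \<in> Inv \<and> q1 * q3 - q2 ^ (t div p) = f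
            \<and> Inv = kalg {q1, q2, q3})
       \<and> (\<psi> ` kalg {X1, X2 ^ p, X3} = Inv
            \<longleftrightarrow> (\<exists>a \<in> kalg {f, g}. h ^ (p - 1) = f ^ l * a))"
proof -
  define F :: "'k poly poly poly" where "F = x1 * x3 - x2 ^ t"
  define R where "R = F ^ l * x2 + x1 ^ m"
  \<comment> \<open>Modulo \<open>x1\<close>, \<open>R\<close> is \<open>F ^ l * x2\<close>, so the
    sum becomes \<open>F ^ (l * t) * (F + x2 ^ t)\<close>, and \<open>F + x2 ^ t = x1 * x3\<close>.
    This is why g is a polynomial.\<close>
  have "x1 dvd F ^ (l * t + 1) + R ^ t"
  proof -
    have "R ^ t - (F ^ l * x2) ^ t = (R - F ^ l * x2) * (\<Sum>i<t. (F ^ l * x2) ^ (t - Suc i) * R ^ i)"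
      by (rule power_diff_sumr2)
    moreover have "x1 dvd R - F ^ l * x2" using m by (simp add: R_def)
    ultimately have "x1 dvd R ^ t - (F ^ l * x2) ^ t" by simp
    moreover have "F ^ (l * t + 1) + R ^ t = x1 * (F ^ (l * t) * x3) + (R ^ t - (F ^ l * x2) ^ t)"
    proof -
      have "F ^ (l * t + 1) = F ^ (l * t) * (x1 * x3 - x2 ^ t)"
        by (simp add: F_def[symmetric])
      then show ?thesis by (simp add: algebra_simps power_mult_distrib power_mult)
    qed
    ultimately show ?thesis by (simp only: dvd_add dvd_triv_left)
  qed
  then obtain G where G: "x1 * G = F ^ (l * t + 1) + R ^ t" by (metis dvdE)
  have f: "f = emb3 F" by (simp add: f_def F_def X_eq)
  have r: "r = emb3 R" by (simp add: r_def R_def f X_eq)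
  have "X1 * emb3 G = f ^ (l * t + 1) + r ^ t"
    using arg_cong[OF G, of emb3] by (simp add: X_eq f r)
  moreover have X1: "X1 \<noteq> (0 :: 'k rat3)"
    using inj_emb3[of "x1 :: 'k poly poly poly" 0] by (simp add: X_eq)
  ultimately have g: "g = emb3 G" by (simp add: g_def field_simps)
  have "h \<in> emb3 ` alg const3 {F, G}" using h(1) by (simp add: kalg_eq_alg emb3_image_alg f g)
  then obtain H where H: "H \<in> alg const3 {F, G}" "h = emb3 H" by blast
  define e where "e = t div p"
  have te: "t = p * e" using pt by (simp add: e_def)
  interpret A: action p l m t e F R G H
    using assms(1-4) mt te G H by unfold_locales (auto simp: F_def R_def)
  have d: "f ^ l * g * h = emb3 A.D" by (simp add: A.D_def f g H)
  have q: "q = emb3 A.Q" by (simp add: q_def A.Q_def d r)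
  have "q1 = inverse g * (g * emb3 A.Q1)" using A.q1_relation by (simp add: q1_def f g q e_def)
  then have q1: "q1 = emb3 A.Q1" using A.fg_neq_0 g by simp
  have C: "C = A.C" by (simp add: C_def A.C_def kalg_eq_alg f g)
  have Inv: "Inv = A.Inv" by (simp add: Inv_def A.Inv_def C r d)
  have \<psi>: "\<psi> = A.\<psi>" by (simp add: \<psi>_def A.\<psi>_def C r q)
  have "H \<noteq> 0" using h(2) H(2) by auto
  have "\<psi> ` kalg {X1, X2 ^ p, X3} = Inv \<longleftrightarrow> (\<exists>a\<in>kalg {f, g}. h ^ (p - 1) = f ^ l * a)"
  proof
    assume "\<psi> ` kalg {X1, X2 ^ p, X3} = Inv"
    then have "A.\<psi> ` alg constK {emb3 x1, emb3 x2 ^ p, emb3 x3} = A.Inv"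
      by (simp add: \<psi> Inv kalg_eq_alg X_eq)
    from A.psi_image_eq_Inv_imp[OF \<open>H \<noteq> 0\<close> this]
    obtain a where a: "a \<in> alg const3 {F, G}" "H ^ (p - 1) = F ^ l * a" by blast
    have "emb3 a \<in> kalg {f, g}" using emb3_in_alg[OF a(1)] by (simp add: kalg_eq_alg f g)
    moreover have "h ^ (p - 1) = f ^ l * emb3 a" using arg_cong[OF a(2), of emb3] by (simp add: H f)
    ultimately show "\<exists>a\<in>kalg {f, g}. h ^ (p - 1) = f ^ l * a" by blast
  next
    assume "\<exists>a\<in>kalg {f, g}. h ^ (p - 1) = f ^ l * a"
    then obtain a where a: "a \<in> kalg {f, g}" "h ^ (p - 1) = f ^ l * a" by blast
    have "a \<in> emb3 ` alg const3 {F, G}" using a(1) by (simp add: kalg_eq_alg emb3_image_alg f g)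
    then obtain b where b: "a = emb3 b" by blast
    have "emb3 (H ^ (p - 1)) = emb3 (F ^ l * b)" using a(2) by (simp add: b H f)
    then have "H ^ (p - 1) = F ^ l * b" by (simp only: inj_emb3)
    then have "F ^ l dvd H ^ (p - 1)" by simp
    from A.psi_image_eq_Inv_if[OF \<open>H \<noteq> 0\<close> this]
    show "\<psi> ` kalg {X1, X2 ^ p, X3} = Inv" by (simp add: \<psi> Inv kalg_eq_alg X_eq)
  qed
  then show ?thesis
    using A.Inv_generators[OF \<open>H \<noteq> 0\<close>] by (simp add: Inv q1 f kalg_eq_alg e_def)
qed

end
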